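(* Fix a positive integer $s$ and a real number $\alpha$ with $\alpha/(2\pi)\notin\mathbb{Q}$. Let $$\Sigma=\{a=(a_{i,j})_{i,j\ge 0,\ i+j>2s}:\ a_{j,i}=\overline{a_{i,j}},\ |a_{i,j}|<1\},$$ and for $a\in\Sigma$ put $\tilde a(z,\bar z)=\sum_{i+j>2s}a_{i,j}z^i\bar z^j$, $\phi_a(z)=z\,e^{i\tilde a(z,\bar z)}$, $T(z)=z\,e^{i(\alpha+(z\bar z)^s)}$, $\tau(z)=\bar z$, and $$\varphi_a=\phi_a\circ T\circ\tau\circ\phi_a^{-1}\circ\tau,$$ a real analytic map of a neighborhood of $0$ in $\mathbb{R}^2=\mathbb{C}$ fixing $0$ (here $\phi_a^{-1}$ is the local inverse near $0$). Then there exists a sequence $(H_k)_{k\ge1}$ of functionally independent power series in the infinitely many variables $a_{i,j}$, each $H_k$ converging for $a\in\Sigma$, with the following property: if $a\in\Sigma$ is fixed and $H_k(a)\neq 0$ for infinitely many $k$, then there is no convergent (real analytic, locally invertible near $0$) transformation $\Phi$ of $\mathbb{R}^2$ fixing $0$ with $\Phi\circ\varphi_a\circ\Phi^{-1}=T$.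
   Context: A power series in infinitely many variables $a_{i,j}$ is said to converge at a point if it converges absolutely there. The map $\varphi_a$ is reversible with respect to $\tau$ ($\varphi_a^{-1}=\tau\varphi_a\tau$), and $z\bar z$ is invariant under $\varphi_a$. *)

theory Defs
  imports "HOL-Analysis.Analysis" "HOL-Library.Poly_Mapping" "HOL-Combinatorics.Permutations"
begin

definition idx :: "nat \<Rightarrow> (nat \<times> nat) set" where
  "idx s = {(i, j). i + j > 2 * s}"

text \<open>Points a = (a_ij), i+j > 2s, with a_ji = conj a_ij and |a_ij| < 1.
  Values of a outside idx s are irrelevant (never used).\<close>
definition Sigma_set :: "nat \<Rightarrow> (nat \<times> nat \<Rightarrow> complex) set" where
  "Sigma_set s = {a. \<forall>i j. i + j > 2 * s \<longrightarrow>
        a (j, i) = cnj (a (i, j)) \<and> norm (a (i, j)) < 1}"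

type_synonym mon = "(nat \<times> nat) \<Rightarrow>\<^sub>0 nat"
type_synonym ps = "mon \<Rightarrow> complex"

definition ps_vars_in :: "(nat \<times> nat) set \<Rightarrow> ps \<Rightarrow> bool" where
  "ps_vars_in V f \<longleftrightarrow> (\<forall>m. f m \<noteq> 0 \<longrightarrow> Poly_Mapping.keys m \<subseteq> V)"

definition ps_monom :: "(nat \<times> nat \<Rightarrow> complex) \<Rightarrow> mon \<Rightarrow> complex" where
  "ps_monom a m = (\<Prod>v\<in>Poly_Mapping.keys m. a v ^ Poly_Mapping.lookup m v)"

definition ps_converges_at :: "ps \<Rightarrow> (nat \<times> nat \<Rightarrow> complex) \<Rightarrow> bool" where
  "ps_converges_at f a \<longleftrightarrow> (\<lambda>m. norm (f m * ps_monom a m)) summable_on UNIV"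

definition ps_eval :: "ps \<Rightarrow> (nat \<times> nat \<Rightarrow> complex) \<Rightarrow> complex" where
  "ps_eval f a = (\<Sum>\<^sub>\<infinity>m. f m * ps_monom a m)"

definition ps_one :: ps where
  "ps_one m = (if m = 0 then 1 else 0)"

definition ps_mult :: "ps \<Rightarrow> ps \<Rightarrow> ps" where
  "ps_mult f g m = (\<Sum>(m1, m2)\<in>{(m1, m2). m1 + m2 = m}. f m1 * g m2)"

fun ps_prodl :: "ps list \<Rightarrow> ps" where
  "ps_prodl [] = ps_one"
| "ps_prodl (f # fs) = ps_mult f (ps_prodl fs)"

definition ps_deriv :: "nat \<times> nat \<Rightarrow> ps \<Rightarrow> ps" where
  "ps_deriv v f m = of_nat (Poly_Mapping.lookup m v + 1) * f (m + Poly_Mapping.single v 1)"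

definition ps_jac_det :: "(nat \<Rightarrow> ps) \<Rightarrow> (nat \<Rightarrow> nat \<times> nat) \<Rightarrow> nat \<Rightarrow> ps" where
  "ps_jac_det H v n m =
     (\<Sum>p\<in>{p. p permutes {..<n}}.
        of_int (sign p) * ps_prodl (map (\<lambda>k. ps_deriv (v (p k)) (H k)) [0..<n]) m)"

text \<open>Functional independence of H_0, ..., H_{n-1}: dH_0 /\ ... /\ dH_{n-1} \<noteq> 0, i.e.
  some n x n minor of the formal Jacobian (w.r.t. variables in V) is a nonzero series.
  A sequence is functionally independent if every initial finite segment is.\<close>
definition ps_func_indep_fin :: "(nat \<times> nat) set \<Rightarrow> (nat \<Rightarrow> ps) \<Rightarrow> nat \<Rightarrow> bool" where
  "ps_func_indep_fin V H n \<longleftrightarrow>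
     (\<exists>v. inj_on v {..<n} \<and> v ` {..<n} \<subseteq> V \<and> ps_jac_det H v n \<noteq> (\<lambda>_. 0))"

definition ps_func_indep_seq :: "(nat \<times> nat) set \<Rightarrow> (nat \<Rightarrow> ps) \<Rightarrow> bool" where
  "ps_func_indep_seq V H \<longleftrightarrow> (\<forall>n. ps_func_indep_fin V H n)"

definition atilde :: "nat \<Rightarrow> (nat \<times> nat \<Rightarrow> complex) \<Rightarrow> complex \<Rightarrow> complex" where
  "atilde s a z = (\<Sum>\<^sub>\<infinity>(i, j)\<in>idx s. a (i, j) * z ^ i * cnj z ^ j)"

definition phi :: "nat \<Rightarrow> (nat \<times> nat \<Rightarrow> complex) \<Rightarrow> complex \<Rightarrow> complex" where
  "phi s a z = z * exp (\<i> * atilde s a z)"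

definition Tmap :: "nat \<Rightarrow> real \<Rightarrow> complex \<Rightarrow> complex" where
  "Tmap s \<alpha> z = z * exp (\<i> * (complex_of_real \<alpha> + (z * cnj z) ^ s))"

definition phi_inv :: "nat \<Rightarrow> (nat \<times> nat \<Rightarrow> complex) \<Rightarrow> complex \<Rightarrow> complex" where
  "phi_inv s a = inv_into (ball 0 (SOME r. r > 0 \<and> inj_on (phi s a) (ball 0 r))) (phi s a)"

definition varphi :: "nat \<Rightarrow> real \<Rightarrow> (nat \<times> nat \<Rightarrow> complex) \<Rightarrow> complex \<Rightarrow> complex" where
  "varphi s \<alpha> a = phi s a \<circ> Tmap s \<alpha> \<circ> cnj \<circ> phi_inv s a \<circ> cnj"

text \<open>Real analytic near 0: given on a neighbourhood of 0 by an absolutely convergent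
  power series in z and conj z (equivalently in x and y).\<close>
definition real_analytic_at0 :: "(complex \<Rightarrow> complex) \<Rightarrow> bool" where
  "real_analytic_at0 \<Phi> \<longleftrightarrow> (\<exists>c :: nat \<Rightarrow> nat \<Rightarrow> complex. \<exists>r > 0. \<forall>z\<in>ball 0 r.
      (\<lambda>(i, j). norm (c i j * z ^ i * cnj z ^ j)) summable_on UNIV \<and>
      \<Phi> z = (\<Sum>\<^sub>\<infinity>(i, j). c i j * z ^ i * cnj z ^ j))"

definition conv_transf :: "(complex \<Rightarrow> complex) \<Rightarrow> bool" where
  "conv_transf \<Phi> \<longleftrightarrow> real_analytic_at0 \<Phi> \<and> \<Phi> 0 = 0 \<and>
     (\<exists>L. (\<Phi> has_derivative L) (at 0) \<and> bij L)"

end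

theory Submission
  imports Defs
begin

text \<open>
  All maps preserve \<open>|z|\<close>, so on each circle one deals with a circle map, and on the circle of radius \<open>r\<close>
  with \<open>\<alpha> + r^(2 s) = 2 \<pi> p / q\<close> the map \<open>T\<close> is \<open>q\<close>-periodic. If \<open>\<Phi>\<close> conjugates \<open>varphi\<close> to \<open>T\<close>, then \<open>|\<Phi>|\<close> is constant
  on circles, so for every \<open>p / q\<close> slightly above \<open>\<alpha> / (2 \<pi>)\<close> there is a whole circle of \<open>q\<close>-periodic points
  with rotation number \<open>p / q\<close>. On the other hand, for each angle \<open>\<theta>\<close> there is a unique \<open>q\<close>-periodic orbit
  of \<open>varphi\<close> through \<open>\<theta>\<close> with this rotation number near radius \<open>r\<close>; let \<open>r exp (h\<^sub>\<theta> / (2 s))\<close> be its radius. Then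
  \<open>H = h\<^sub>\<theta> - h\<^sub>0\<close> with \<open>\<theta> = \<pi> / q\<close> vanishes at \<open>a\<close> whenever \<open>\<Phi>\<close> exists and \<open>q\<close> is large.

  The periodic orbit is the fixed point of a contraction. The same contraction acts in the Banach algebra of
  absolutely summable power series in the \<open>a\<^sub>i\<^sub>j\<close> (with the variables as elements of norm \<open>1\<close>), and its fixed
  point there is \<open>h\<^sub>\<theta>\<close> as a power series converging on the whole polydisc. To first order only the \<open>a\<^sub>i\<^sub>j\<close> with
  \<open>q\<close> dividing \<open>i - j\<close> enter, so along a sequence of increasing denominators \<open>q\<^sub>k\<close> the Jacobian of the \<open>H\<^sub>k\<close>
  with respect to the variables \<open>a\<close> with index \<open>(q\<^sub>k, 0)\<close> is triangular at the origin.
\<close>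

section \<open>Double power series and the exponential in a commutative Banach algebra\<close>

text \<open>The conjugate of \<open>z\<close> becomes an independent variable \<open>w\<close>, so that the series makes sense in any Banach algebra.\<close>

definition dser :: "nat \<Rightarrow> (nat \<times> nat \<Rightarrow> 'b) \<Rightarrow> 'b \<Rightarrow> 'b \<Rightarrow> 'b::{real_normed_algebra_1,comm_ring_1,banach}" where
  "dser n X z w = (\<Sum>\<^sub>\<infinity>(i, j)\<in>{(i, j). n < i + j}. X (i, j) * z ^ i * w ^ j)"

section \<open>Lipschitz bounds for monomials and double power series\<close>

lemma norm_power_diff_le:
  fixes x y :: "'b::{real_normed_algebra_1,comm_ring_1}"
  assumes "norm x \<le> R" "norm y \<le> R"
  shows "norm (x ^ k - y ^ k) \<le> real k * R ^ (k - 1) * norm (x - y)"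
proof (induction k)
  case (Suc k)
  have R: "0 \<le> R" using assms norm_ge_zero order_trans by blast
  have "x ^ Suc k - y ^ Suc k = x * (x ^ k - y ^ k) + (x - y) * y ^ k"
    by (simp add: algebra_simps)
  also have "norm \<dots> \<le> R * (real k * R ^ (k - 1) * norm (x - y)) + norm (x - y) * R ^ k"
  proof (rule norm_triangle_le, rule add_mono)
    show "norm (x * (x ^ k - y ^ k)) \<le> R * (real k * R ^ (k - 1) * norm (x - y))"
      using R by (intro order_trans[OF norm_mult_ineq] mult_mono Suc.IH assms) auto
    show "norm ((x - y) * y ^ k) \<le> norm (x - y) * R ^ k"
      by (intro order_trans[OF norm_mult_ineq] mult_mono order_trans[OF norm_power_ineq] power_mono assms) auto
  qed
  also have "R * (real k * R ^ (k - 1) * norm (x - y)) = real k * R ^ k * norm (x - y)"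
    by (cases k) auto
  finally show ?case by (simp add: algebra_simps)
qed auto

lemma norm_monomial_diff_le:
  fixes z w z' w' :: "'b::{real_normed_algebra_1,comm_ring_1}"
  assumes "norm z \<le> R" "norm w \<le> R" "norm z' \<le> R" "norm w' \<le> R"
    and D: "norm (z - z') \<le> D" "norm (w - w') \<le> D"
  shows "norm (z ^ i * w ^ j - z' ^ i * w' ^ j) \<le> real (i + j) * R ^ (i + j - 1) * D"
proof -
  have R: "0 \<le> R" using assms norm_ge_zero order_trans by blast
  have "z ^ i * w ^ j - z' ^ i * w' ^ j = (z ^ i - z' ^ i) * w ^ j + z' ^ i * (w ^ j - w' ^ j)"
    by (simp add: algebra_simps)
  also have "norm \<dots> \<le> (real i * R ^ (i - 1) * D) * R ^ j + R ^ i * (real j * R ^ (j - 1) * D)"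
  proof (rule norm_triangle_le, rule add_mono)
    have "norm (z ^ i - z' ^ i) \<le> real i * R ^ (i - 1) * D"
      using R by (intro order_trans[OF norm_power_diff_le[OF assms(1,3)]] mult_left_mono D) auto
    then show "norm ((z ^ i - z' ^ i) * w ^ j) \<le> (real i * R ^ (i - 1) * D) * R ^ j"
      by (intro order_trans[OF norm_mult_ineq] mult_mono order_trans[OF norm_power_ineq] power_mono assms)
         (auto intro: order_trans[OF norm_ge_zero])
    have "norm (w ^ j - w' ^ j) \<le> real j * R ^ (j - 1) * D"
      using R by (intro order_trans[OF norm_power_diff_le[OF assms(2,4)]] mult_left_mono D) auto
    then show "norm (z' ^ i * (w ^ j - w' ^ j)) \<le> R ^ i * (real j * R ^ (j - 1) * D)"
      using R
      by (intro order_trans[OF norm_mult_ineq] mult_mono order_trans[OF norm_power_ineq] power_mono assms) auto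
  qed
  also have "\<dots> = real (i + j) * R ^ (i + j - 1) * D"
    by (cases i; cases j) (auto simp: algebra_simps power_add)
  finally show ?thesis .
qed

text \<open>The common majorant of all double series here: coefficients have norm at most 1 and
  variables norm at most 1/4.\<close>

lemma has_sum_half_powers: "((\<lambda>(i, j). (1/2) ^ (i + j) :: real) has_sum 4) UNIV"
proof -
  have g: "((\<lambda>i. (1/2) ^ i :: real) has_sum 2) UNIV"
    using geometric_sums[of "1/2::real"] by (intro sums_nonneg_imp_has_sum) auto
  have r: "((\<lambda>j. (case (i, j) of (i, j) \<Rightarrow> (1/2) ^ (i + j)) :: real) has_sum (1/2) ^ i * 2) UNIV" for i
    using has_sum_cmult_right[OF g, of "(1/2)^i"] by (simp add: power_add)
  have s: "((\<lambda>i. (1/2) ^ i * 2 :: real) has_sum 4) UNIV"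
    using has_sum_cmult_left[OF g, of 2] by simp
  have "((\<lambda>(i, j). (1/2) ^ (i + j) :: real) has_sum 4) (UNIV \<times> UNIV)"
    by (rule has_sum_SigmaI[OF r s], rule summable_on_SigmaI[OF r has_sum_imp_summable[OF s]]) auto
  then show ?thesis by simp
qed

context
  fixes X :: "nat \<times> nat \<Rightarrow> 'b::{real_normed_algebra_1,comm_ring_1,banach}" and n :: nat and R :: real
  assumes X: "\<And>i j. n < i + j \<Longrightarrow> norm (X (i, j)) \<le> 1" and R4: "R \<le> 1/4"
begin

text \<open>Of the decay \<open>(1/4) ^ k\<close>, a factor \<open>(1/2) ^ k\<close> absorbs the
  linear factor \<open>k\<close>, since \<open>k\<close> is at most \<open>2 ^ k\<close>, and the
  rest remains summable. The factor \<open>R ^ n\<close> is kept out of this trade.\<close>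

private lemma term_bound:
  assumes "n < k" "0 \<le> R"
  shows "real k * R ^ (k - 1) \<le> R ^ n * 4 ^ (n + 1) * (1/2) ^ k"
proof -
  obtain l where k: "k = n + 1 + l" using \<open>n < k\<close> less_iff_Suc_add by auto
  have "real k \<le> 2 ^ k" using of_nat_less_two_power[of k, where 'a=real] by simp
  moreover have "R ^ (k - 1) \<le> R ^ n * (1/4) ^ l"
    using assms R4 k by (simp add: power_add mult_left_mono power_mono)
  ultimately have "real k * R ^ (k - 1) \<le> 2 ^ k * (R ^ n * (1/4) ^ l)"
    using assms by (intro mult_mono) auto
  also have "\<dots> = R ^ n * 4 ^ (n + 1) * (1/2) ^ k"
  proof -
    have "(1/4::real) ^ l = 4 ^ (n + 1) * (1/4) ^ k"
      by (simp add: k power_add power_divide)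
    moreover have "(2::real) ^ k * (1/4) ^ k = (1/2) ^ k"
      by (subst power_mult_distrib[symmetric]) simp
    ultimately have "(2::real) ^ k * (1/4) ^ l = 4 ^ (n + 1) * (1/2) ^ k"
      by (metis mult.left_commute)
    then show ?thesis by (metis mult.left_commute mult.assoc)
  qed
  finally show ?thesis .
qed

lemma dser_summable:
  assumes "norm z \<le> R" "norm w \<le> R"
  shows "(\<lambda>(i, j). X (i, j) * z ^ i * w ^ j) summable_on {(i, j). n < i + j}"
proof -
  have R: "0 \<le> R" using assms norm_ge_zero order_trans by blast
  have "norm (X (i, j) * z ^ i * w ^ j) \<le> (1/2) ^ (i + j)" if "n < i + j" for i j
  proof -
    have "norm (X (i, j) * z ^ i * w ^ j) \<le> 1 * R ^ i * R ^ j"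
      using assms R X that
      by (intro order_trans[OF norm_mult_ineq] mult_mono order_trans[OF norm_power_ineq] power_mono) auto
    also have "\<dots> \<le> 1 * (1/2) ^ i * (1/2) ^ j" using R R4 by (intro mult_mono power_mono) auto
    finally show ?thesis by (simp add: power_add)
  qed
  then have s: "(\<lambda>p. norm (case p of (i, j) \<Rightarrow> X (i, j) * z ^ i * w ^ j)) summable_on {(i, j). n < i + j}"
    by (intro summable_on_comparison_test[OF
          summable_on_subset_banach[OF has_sum_imp_summable[OF has_sum_half_powers] subset_UNIV]]) auto
  from abs_summable_summable[OF s]
  show "(\<lambda>(i, j). X (i, j) * z ^ i * w ^ j) summable_on {(i, j). n < i + j}" .
qed

text \<open>Every monomial has degree at least \<open>n + 1\<close>, so its increment still carries
  \<open>n\<close> factors of size \<open>R\<close>. With \<open>n = 2 s\<close>, and points that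
  are themselves Lipschitz of size \<open>r\<close>, this makes the perturbation of order
  \<open>r^(2 s + 1)\<close>, weaker than the twist, which is of order
  \<open>r^(2 s)\<close>.\<close>

lemma dser_lipschitz:
  assumes zw: "norm z \<le> R" "norm w \<le> R" and zw': "norm z' \<le> R" "norm w' \<le> R"
    and D: "norm (z - z') \<le> D" "norm (w - w') \<le> D"
  shows "norm (dser n X z w - dser n X z' w') \<le> 4 ^ (n + 2) * R ^ n * D"
proof -
  have R: "0 \<le> R" using assms norm_ge_zero order_trans by blast
  have D0: "0 \<le> D" using D norm_ge_zero order_trans by blast
  let ?I = "{(i, j). n < i + j}"
  let ?d = "\<lambda>(i, j). X (i, j) * z ^ i * w ^ j - X (i, j) * z' ^ i * w' ^ j"
  have "((\<lambda>p. (case p of (i, j) \<Rightarrow> X (i, j) * z ^ i * w ^ j)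
            - (case p of (i, j) \<Rightarrow> X (i, j) * z' ^ i * w' ^ j)) has_sum (dser n X z w - dser n X z' w')) ?I"
    unfolding dser_def
    using has_sum_add[OF has_sum_infsum[OF dser_summable[OF zw]]
        has_sum_uminusI[OF has_sum_infsum[OF dser_summable[OF zw']]]] by simp
  then have eq: "dser n X z w - dser n X z' w' = infsum ?d ?I"
    by (simp add: has_sum_iff case_prod_unfold)
  define g where "g = (\<lambda>(i, j). R ^ n * 4 ^ (n + 1) * D * (1/2) ^ (i + j) :: real)"
  have g: "(g has_sum (R ^ n * 4 ^ (n + 1) * D * 4)) UNIV"
    using has_sum_cmult_right[OF has_sum_half_powers, of "R ^ n * 4 ^ (n + 1) * D"]
    by (simp add: g_def case_prod_unfold)
  have gI: "g summable_on ?I" by (rule summable_on_subset_banach[OF has_sum_imp_summable[OF g]]) auto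
  have le: "norm (?d p) \<le> g p" if p: "p \<in> ?I" for p
  proof -
    obtain i j where ij: "p = (i, j)" "n < i + j" using p by auto
    have "norm (?d p) = norm (X (i, j) * (z ^ i * w ^ j - z' ^ i * w' ^ j))"
      by (simp add: ij algebra_simps)
    also have "\<dots> \<le> 1 * (real (i + j) * R ^ (i + j - 1) * D)"
      using ij X zw zw' D by (intro order_trans[OF norm_mult_ineq] mult_mono norm_monomial_diff_le) auto
    also have "\<dots> \<le> (R ^ n * 4 ^ (n + 1) * (1/2) ^ (i + j)) * D"
      using mult_right_mono[OF term_bound[OF ij(2) R] D0] by simp
    finally show ?thesis by (simp add: g_def ij ac_simps)
  qed
  have "norm (infsum ?d ?I) \<le> infsum g ?I"
    by (rule norm_infsum_le[OF has_sum_infsum has_sum_infsum[OF gI]])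
       (use le abs_summable_summable[OF summable_on_comparison_test[OF gI le]] in auto)
  also have "\<dots> \<le> infsum g UNIV"
    by (rule infsum_mono2[OF gI has_sum_imp_summable[OF g]]) (use R D0 in \<open>auto simp: g_def\<close>)
  also have "\<dots> = 4 ^ (n + 2) * R ^ n * D"
    using g by (simp add: has_sum_iff)
  finally show ?thesis by (simp add: eq)
qed

lemma dser_0_0: "dser n X 0 0 = 0"
  unfolding dser_def by (rule infsum_0) (auto simp: power_0_left)

lemma dser_norm_le:
  assumes zw: "norm z \<le> R" "norm w \<le> R"
  shows "norm (dser n X z w) \<le> 4 ^ (n + 2) * R ^ (n + 1)"
  using dser_lipschitz[OF zw, of 0 0 R] zw order_trans[OF norm_ge_zero zw(1)] by (simp add: dser_0_0 ac_simps)

end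

text \<open>Without its linear term the exponential consists of \<open>x^n / n!\<close> with
  \<open>n\<close> at least 2 and a constant; the Lipschitz constants
  \<open>M^(n-1) / (n-1)!\<close> of these terms sum to \<open>exp M - 1\<close>. For
  \<open>M = 1/4\<close> this is below 1, which makes \<open>h - (exp h - 1)\<close>
  contracting.\<close>

lemma norm_exp_diff_sub_le:
  fixes x y :: "'b::{real_normed_algebra_1,comm_ring_1,banach}"
  assumes "norm x \<le> M" "norm y \<le> M"
  shows "norm ((exp x - x) - (exp y - y)) \<le> (exp M - 1) * norm (x - y)"
proof -
  have M: "0 \<le> M" using assms norm_ge_zero order_trans by blast
  define e where "e = (\<lambda>x::'b. \<lambda>n. (x ^ Suc n) /\<^sub>R fact (Suc n))"
  have es: "e x sums (exp x - 1)" for x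
    using exp_converges[of x] unfolding e_def by (subst sums_Suc_iff) simp
  have es': "(\<lambda>n. e x (Suc n)) sums (exp x - 1 - x)" for x
    using es[of x] by (subst sums_Suc_iff) (simp add: e_def algebra_simps)
  have d: "(\<lambda>n. e x (Suc n) - e y (Suc n)) sums ((exp x - x) - (exp y - y))"
    using sums_diff[OF es'[of x] es'[of y]] by (simp add: algebra_simps)
  have gM: "(\<lambda>n. M ^ Suc n /\<^sub>R fact (Suc n)) sums (exp M - 1)"
    using exp_converges[of M] by (subst sums_Suc_iff) simp
  note g = sums_mult2[OF gM, of "norm (x - y)"]
  have le: "norm (e x (Suc n) - e y (Suc n)) \<le> M ^ Suc n /\<^sub>R fact (Suc n) * norm (x - y)" for n
  proof -
    have "e x (Suc n) - e y (Suc n) = (x ^ Suc (Suc n) - y ^ Suc (Suc n)) /\<^sub>R fact (Suc (Suc n))"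
      by (simp add: e_def scaleR_right_diff_distrib)
    also have "norm \<dots> \<le> (real (Suc (Suc n)) * M ^ Suc n * norm (x - y)) / fact (Suc (Suc n))"
      using norm_power_diff_le[OF assms, of "Suc (Suc n)"]
      by (simp add: divide_inverse_commute del: power_Suc of_nat_Suc fact_Suc)
    also have "\<dots> = M ^ Suc n /\<^sub>R fact (Suc n) * norm (x - y)"
      by (subst fact_Suc) (simp add: field_simps del: power_Suc of_nat_Suc fact_Suc)
    finally show ?thesis .
  qed
  have "norm (suminf (\<lambda>n. e x (Suc n) - e y (Suc n))) \<le> suminf (\<lambda>n. M ^ Suc n /\<^sub>R fact (Suc n) * norm (x - y))"
    by (rule norm_suminf_le[OF le sums_summable[OF g]])
  then show ?thesis using sums_unique[OF d] sums_unique[OF g] by simp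
qed

lemma norm_exp_diff_le:
  fixes x y :: "'b::{real_normed_algebra_1,comm_ring_1,banach}"
  assumes "norm x \<le> M" "norm y \<le> M"
  shows "norm (exp x - exp y) \<le> exp M * norm (x - y)"
  using norm_exp_diff_sub_le[OF assms] norm_triangle_ineq[of "(exp x - x) - (exp y - y)" "x - y"]
  by (simp add: algebra_simps)

section \<open>The Banach algebra of absolutely summable power series\<close>

text \<open>The exponents of a left factor are bounded by those of \<open>m\<close>, so it is
  determined by a bounded function on the finitely many variables of \<open>m\<close>; the right
  factor is then a difference.\<close>

lemma finite_mon_decompositions: "finite {(m1, m2). m1 + m2 = (m :: mon)}"
proof -
  let ?L = "{m1 :: mon. \<forall>v. Poly_Mapping.lookup m1 v \<le> Poly_Mapping.lookup m v}"
  let ?r = "\<lambda>m1 :: mon. restrict (Poly_Mapping.lookup m1) (Poly_Mapping.keys m)"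
  have "inj_on ?r ?L"
  proof (rule inj_onI)
    fix a b assume a: "a \<in> ?L" and b: "b \<in> ?L" and eq: "?r a = ?r b"
    show "a = b"
    proof (rule poly_mapping_eqI)
      fix v
      show "Poly_Mapping.lookup a v = Poly_Mapping.lookup b v"
      proof (cases "v \<in> Poly_Mapping.keys m")
        case True
        then show ?thesis using fun_cong[OF eq, of v] by simp
      next
        case False
        then show ?thesis using a b by (metis (mono_tags) in_keys_iff le_zero_eq mem_Collect_eq)
      qed
    qed
  qed
  moreover have "?r ` ?L \<subseteq> Pi\<^sub>E (Poly_Mapping.keys m) (\<lambda>v. {..Poly_Mapping.lookup m v})"
    by auto
  ultimately have "finite ?L"
    by (meson finite_PiE finite_atMost finite_imageD finite_keys finite_subset)
  moreover have "{(m1, m2). m1 + m2 = m} \<subseteq> (\<lambda>m1. (m1, m - m1)) ` ?L"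
    by (auto simp: lookup_add image_iff)
  ultimately show ?thesis by (meson finite_imageI finite_subset)
qed

section \<open>Cauchy products of absolutely summable series\<close>

lemma has_sum_product:
  fixes f g :: "'i \<Rightarrow> complex"
  assumes f: "(\<lambda>x. norm (f x)) summable_on A" and g: "(\<lambda>x. norm (g x)) summable_on B"
  shows "((\<lambda>(x, y). f x * g y) has_sum (infsum f A * infsum g B)) (A \<times> B)"
proof (rule has_sum_SigmaI)
  show "((\<lambda>y. case (x, y) of (x, y) \<Rightarrow> f x * g y) has_sum (f x * infsum g B)) B" for x
    using has_sum_cmult_right[OF has_sum_infsum[OF abs_summable_summable[OF g]], of "f x"] by simp
  show "((\<lambda>x. f x * infsum g B) has_sum (infsum f A * infsum g B)) A"
    by (rule has_sum_cmult_left[OF has_sum_infsum[OF abs_summable_summable[OF f]]])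
  have "(\<lambda>p. norm (case p of (x, y) \<Rightarrow> f x * g y)) summable_on A \<times> B"
    by (rule summable_on_SigmaI[where g = "\<lambda>x. norm (f x) * infsum (\<lambda>y. norm (g y)) B"])
       (auto simp: norm_mult intro!: has_sum_cmult_right has_sum_infsum g summable_on_cmult_left f)
  then show "(\<lambda>(x, y). f x * g y) summable_on A \<times> B"
    by (rule abs_summable_summable)
qed

text \<open>The unconditional sum over all pairs of monomials is regrouped according to their
  product.\<close>

lemma ps_mult_has_sum:
  assumes f: "(\<lambda>m. norm (f m)) summable_on UNIV" and g: "(\<lambda>m. norm (g m)) summable_on UNIV"
  shows "(ps_mult f g has_sum (infsum f UNIV * infsum g UNIV)) UNIV"
proof -
  let ?S = "SIGMA m:UNIV. {(m1, m2). m1 + m2 = (m :: mon)}"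
  have "bij_betw snd ?S UNIV"
    by (rule bij_betwI[where g = "\<lambda>p. (fst p + snd p, p)"]) auto
  then have "((\<lambda>x. case snd x of (m1, m2) \<Rightarrow> f m1 * g m2) has_sum (infsum f UNIV * infsum g UNIV)) ?S"
    by (subst has_sum_reindex_bij_betw) (use has_sum_product[OF f g] in auto)
  then show ?thesis
    by (rule has_sum_SigmaD) (simp add: ps_mult_def has_sum_finite[OF finite_mon_decompositions])
qed

text \<open>The product of the two series of norms dominates the norms of the product
  coefficientwise, and its total is given by \<open>ps_mult_has_sum\<close>.\<close>

lemma ps_mult_norm_summable:
  assumes f: "(\<lambda>m. norm (f m)) summable_on UNIV" and g: "(\<lambda>m. norm (g m)) summable_on UNIV"
  shows "(\<lambda>m. norm (ps_mult f g m)) summable_on UNIV"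
    and "infsum (\<lambda>m. norm (ps_mult f g m)) UNIV
         \<le> infsum (\<lambda>m. norm (f m)) UNIV * infsum (\<lambda>m. norm (g m)) UNIV"
proof -
  let ?f = "\<lambda>m. complex_of_real (norm (f m))" and ?g = "\<lambda>m. complex_of_real (norm (g m))"
  have "(ps_mult ?f ?g has_sum (infsum ?f UNIV * infsum ?g UNIV)) UNIV"
    using f g by (intro ps_mult_has_sum) auto
  moreover have "ps_mult ?f ?g = (\<lambda>m. of_real (\<Sum>(m1, m2)\<in>{(m1, m2). m1 + m2 = m}. norm (f m1) * norm (g m2)))"
    by (auto simp: ps_mult_def case_prod_unfold)
  moreover have "infsum ?f UNIV * infsum ?g UNIV
      = of_real (infsum (\<lambda>m. norm (f m)) UNIV * infsum (\<lambda>m. norm (g m)) UNIV)"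
    using has_sum_of_real[OF has_sum_infsum[OF f], where 'a=complex]
      has_sum_of_real[OF has_sum_infsum[OF g], where 'a=complex]
    by (simp add: has_sum_iff)
  ultimately have h: "((\<lambda>m. \<Sum>(m1, m2)\<in>{(m1, m2). m1 + m2 = m}. norm (f m1) * norm (g m2))
      has_sum (infsum (\<lambda>m. norm (f m)) UNIV * infsum (\<lambda>m. norm (g m)) UNIV)) UNIV"
    by (simp add: has_sum_of_real_iff del: of_real_sum of_real_mult)
  have le: "norm (ps_mult f g m) \<le> (\<Sum>(m1, m2)\<in>{(m1, m2). m1 + m2 = m}. norm (f m1) * norm (g m2))" for m
    unfolding ps_mult_def by (rule order_trans[OF norm_sum]) (auto intro!: sum_mono simp: norm_mult)
  show s: "(\<lambda>m. norm (ps_mult f g m)) summable_on UNIV"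
    by (rule summable_on_comparison_test[OF has_sum_imp_summable[OF h] le]) auto
  show "infsum (\<lambda>m. norm (ps_mult f g m)) UNIV
         \<le> infsum (\<lambda>m. norm (f m)) UNIV * infsum (\<lambda>m. norm (g m)) UNIV"
    by (rule has_sum_mono[OF has_sum_infsum[OF s] h le])
qed

lemma ps_mult_commute: "ps_mult f g = ps_mult g f"
proof
  show "ps_mult f g m = ps_mult g f m" for m
    unfolding ps_mult_def
    by (rule sum.reindex_bij_witness[of _ prod.swap prod.swap]) (auto simp: ac_simps)
qed

lemma ps_mult_assoc: "ps_mult (ps_mult f g) h = ps_mult f (ps_mult g h)"
proof
  fix m
  let ?D = "\<lambda>m :: mon. {(m1, m2). m1 + m2 = m}"
  have "ps_mult (ps_mult f g) h m = (\<Sum>(p, q)\<in>(SIGMA p:?D m. ?D (fst p)). f (fst q) * g (snd q) * h (snd p))"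
    unfolding ps_mult_def
    by (subst sum.Sigma[symmetric])
       (auto simp: sum_distrib_right case_prod_beta' intro!: finite_mon_decompositions[unfolded case_prod_beta'])
  also have "\<dots> = (\<Sum>(p, q)\<in>(SIGMA p:?D m. ?D (snd p)). f (fst p) * (g (fst q) * h (snd q)))"
    by (rule sum.reindex_bij_witness
        [of _ "\<lambda>(p, q). ((fst p + fst q, snd q), (fst p, fst q))"
              "\<lambda>(p, q). ((fst q, snd q + snd p), (snd q, snd p))"]) (auto simp: ac_simps)
  also have "\<dots> = ps_mult f (ps_mult g h) m"
    unfolding ps_mult_def
    by (subst sum.Sigma[symmetric])
       (auto simp: sum_distrib_left case_prod_beta' intro!: finite_mon_decompositions[unfolded case_prod_beta'])
  finally show "ps_mult (ps_mult f g) h m = ps_mult f (ps_mult g h) m" .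
qed

lemma ps_mult_const: "ps_mult (\<lambda>m. if m = 0 then c else 0) f m = c * f m"
proof -
  have "ps_mult (\<lambda>m. if m = 0 then c else 0) f m
      = (\<Sum>p\<in>{(m1, m2). m1 + m2 = m}. if p = (0, m) then c * f m else 0)"
    unfolding ps_mult_def by (rule sum.cong) (auto split: if_splits)
  then show ?thesis using finite_mon_decompositions[of m] by simp
qed

lemma ps_mult_add_left: "ps_mult (\<lambda>m. f m + g m) h m = ps_mult f h m + ps_mult g h m"
  by (simp add: ps_mult_def algebra_simps case_prod_unfold sum.distrib)

lemma ps_mult_scaleR_left: "ps_mult (\<lambda>m. c *\<^sub>R f m) h m = c *\<^sub>R ps_mult f h m"
  by (simp add: ps_mult_def case_prod_unfold scaleR_sum_right)

section \<open>Algebra structure, norm and completeness\<close>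

typedef ell1 = "{f :: ps. (\<lambda>m. norm (f m)) summable_on UNIV}"
  morphisms coef Ell1
  by (rule exI[of _ "\<lambda>_. 0"]) auto

text \<open>Monomials are to stay abstract when statements about series are transferred.\<close>

lifting_forget poly_mapping.lifting
setup_lifting type_definition_ell1

lemma coef_summable: "(\<lambda>m. norm (coef f m)) summable_on UNIV"
  using coef[of f] by simp

lift_definition ell1_delta :: "mon \<Rightarrow> complex \<Rightarrow> ell1" is "\<lambda>k c m. if m = k then c else 0"
  by (rule finite_nonzero_values_imp_summable_on) (auto intro: finite_subset[of _ "{_}"])

instantiation ell1 :: "{comm_ring_1, real_normed_algebra_1}"
begin

lift_definition zero_ell1 :: ell1 is "\<lambda>_. 0" by auto
lift_definition one_ell1 :: ell1 is "\<lambda>m. if m = 0 then 1 else 0"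
  by (rule finite_nonzero_values_imp_summable_on) (auto intro: finite_subset[of _ "{_}"])
lift_definition plus_ell1 :: "ell1 \<Rightarrow> ell1 \<Rightarrow> ell1" is "\<lambda>f g m. f m + g m"
  by (rule summable_on_comparison_test[OF summable_on_add norm_triangle_ineq]) auto
lift_definition uminus_ell1 :: "ell1 \<Rightarrow> ell1" is "\<lambda>f m. - f m" by simp
lift_definition minus_ell1 :: "ell1 \<Rightarrow> ell1 \<Rightarrow> ell1" is "\<lambda>f g m. f m - g m"
  by (rule summable_on_comparison_test[OF summable_on_add norm_triangle_ineq4]) auto
lift_definition times_ell1 :: "ell1 \<Rightarrow> ell1 \<Rightarrow> ell1" is ps_mult
  by (rule ps_mult_norm_summable(1))
lift_definition scaleR_ell1 :: "real \<Rightarrow> ell1 \<Rightarrow> ell1" is "\<lambda>c f m. c *\<^sub>R f m"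
  by (simp add: summable_on_cmult_right)
lift_definition norm_ell1 :: "ell1 \<Rightarrow> real" is "\<lambda>f. infsum (\<lambda>m. norm (f m)) UNIV" .

definition dist_ell1 :: "ell1 \<Rightarrow> ell1 \<Rightarrow> real" where "dist_ell1 f g = norm (f - g)"
definition sgn_ell1 :: "ell1 \<Rightarrow> ell1" where "sgn_ell1 f = scaleR (inverse (norm f)) f"
definition uniformity_ell1 :: "(ell1 \<times> ell1) filter"
  where "uniformity_ell1 = (INF e\<in>{0 <..}. principal {(x, y). dist x y < e})"
definition open_ell1 :: "ell1 set \<Rightarrow> bool"
  where "open_ell1 U = (\<forall>x\<in>U. \<forall>\<^sub>F (x', y) in uniformity. x' = x \<longrightarrow> y \<in> U)"

instance
proof
  fix f g h :: ell1 and a b :: real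
  show "f + g + h = f + (g + h)" "f + g = g + f" "0 + f = f" "- f + f = 0" "f - g = f + - g"
    by (transfer; auto)+
  show "f * g * h = f * (g * h)" by transfer (rule ps_mult_assoc)
  have C: "f * g = g * f" for f g :: ell1 by transfer (rule ps_mult_commute)
  have D: "(f + g) * h = f * h + g * h" for f g h :: ell1 by transfer (auto simp: ps_mult_add_left)
  have I: "1 * f = f" for f :: ell1 by transfer (auto simp: ps_mult_const)
  show "f * g = g * f" by (rule C)
  show "(f + g) * h = f * h + g * h" by (rule D)
  show "f * (g + h) = f * g + f * h" using D[of g h f] by (simp only: C[of f])
  show "1 * f = f" by (rule I)
  show "f * 1 = f" using I[of f] by (simp only: C[of f])
  show "(0::ell1) \<noteq> 1" by transfer (auto simp: fun_eq_iff)
  show "a *\<^sub>R (f + g) = a *\<^sub>R f + a *\<^sub>R g" "(a + b) *\<^sub>R f = a *\<^sub>R f + b *\<^sub>R f"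
    "a *\<^sub>R b *\<^sub>R f = (a * b) *\<^sub>R f" "1 *\<^sub>R f = f"
    by (transfer; simp add: algebra_simps)+
  show L: "a *\<^sub>R f * g = a *\<^sub>R (f * g)" for f g :: ell1 by transfer (auto simp: ps_mult_scaleR_left)
  show "f * a *\<^sub>R g = a *\<^sub>R (f * g)" using L[of g f] by (simp only: C[of f])
  show "dist f g = norm (f - g)" by (rule dist_ell1_def)
  show "sgn f = scaleR (inverse (norm f)) f" by (rule sgn_ell1_def)
  show "uniformity = (INF e\<in>{0 <..}. principal {(x::ell1, y). dist x y < e})" by (rule uniformity_ell1_def)
  show "open U = (\<forall>x\<in>U. \<forall>\<^sub>F (x', y) in uniformity. x' = x \<longrightarrow> y \<in> U)" for U :: "ell1 set"
    by (rule open_ell1_def)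
  show "(norm f = 0) = (f = 0)"
  proof
    assume "norm f = 0"
    then have "norm (coef f m) = 0" for m
      using nonneg_infsum_le_0D[of "\<lambda>m. norm (coef f m)" UNIV m] coef_summable[of f]
      by (auto simp: norm_ell1.rep_eq)
    then show "f = 0" by transfer auto
  qed (transfer, simp)
  show "norm (f + g) \<le> norm f + norm g"
  proof transfer
    fix f g :: ps
    assume f: "(\<lambda>m. norm (f m)) summable_on UNIV" and g: "(\<lambda>m. norm (g m)) summable_on UNIV"
    note s = summable_on_add[OF f g]
    have "(\<lambda>m. norm (f m + g m)) summable_on UNIV"
      by (rule summable_on_comparison_test[OF s norm_triangle_ineq]) auto
    then have "infsum (\<lambda>m. norm (f m + g m)) UNIV \<le> infsum (\<lambda>m. norm (f m) + norm (g m)) UNIV"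
      by (rule infsum_mono[OF _ s norm_triangle_ineq])
    then show "infsum (\<lambda>m. norm (f m + g m)) UNIV \<le> infsum (\<lambda>m. norm (f m)) UNIV + infsum (\<lambda>m. norm (g m)) UNIV"
      using f g by (simp add: infsum_add)
  qed
  show "norm (a *\<^sub>R f) = \<bar>a\<bar> * norm f"
    by transfer (simp add: infsum_cmult_right')
  show "norm (f * g) \<le> norm f * norm g"
    by transfer (rule ps_mult_norm_summable(2))
  show "norm (1::ell1) = 1"
  proof transfer
    have "infsum (\<lambda>m::mon. norm (if m = 0 then 1 else 0 :: complex)) UNIV = infsum (\<lambda>m::mon. 1) {0}"
      by (rule infsum_cong_neutral) auto
    then show "infsum (\<lambda>m::mon. norm (if m = 0 then 1 else 0 :: complex)) UNIV = 1" by simp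
  qed
qed

end

lemma norm_coef_le: "norm (coef f m) \<le> norm f"
  using finite_sum_le_infsum[OF coef_summable[of f], of "{m}"] by (simp add: norm_ell1.rep_eq)

lemma norm_ell1_delta: "norm (ell1_delta k c) = norm c"
proof transfer
  fix k :: mon and c :: complex
  have "infsum (\<lambda>m. norm (if m = k then c else 0)) UNIV = infsum (\<lambda>m. norm c) {k}"
    by (rule infsum_cong_neutral) auto
  then show "infsum (\<lambda>m. norm (if m = k then c else 0)) UNIV = norm c" by simp
qed

lemma ell1_Cauchy_convergent:
  fixes X :: "nat \<Rightarrow> ell1"
  assumes "Cauchy X"
  shows "\<exists>f. X \<longlonglongrightarrow> f"
proof -
  have C: "\<exists>N. \<forall>i\<ge>N. \<forall>j\<ge>N. norm (X i - X j) < e" if "e > 0" for e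
    using assms that by (meson CauchyD)
  have "convergent (\<lambda>n. coef (X n) m)" for m
  proof (rule Cauchy_convergent, rule CauchyI)
    fix e :: real assume "e > 0"
    from C[OF this] show "\<exists>N. \<forall>i\<ge>N. \<forall>j\<ge>N. norm (coef (X i) m - coef (X j) m) < e"
      using norm_coef_le[of _ m] by (metis minus_ell1.rep_eq order_le_less_trans)
  qed
  then obtain f where f: "(\<lambda>n. coef (X n) m) \<longlonglongrightarrow> f m" for m
    unfolding convergent_def by metis
  \<comment> \<open>The Cauchy bound holds for sums over finite sets of monomials, where the limit
    in \<open>j\<close> may be taken termwise. As the bound does not depend on \<open>F\<close>, it
    passes to the full sum.\<close>
  have fin: "(\<Sum>m\<in>F. norm (coef (X i) m - f m)) \<le> e"
    if N: "\<forall>i\<ge>N. \<forall>j\<ge>N. norm (X i - X j) < e" and "i \<ge> N" and "finite F" for N e i F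
  proof (rule tendsto_upperbound)
    show "(\<lambda>j. \<Sum>m\<in>F. norm (coef (X i) m - coef (X j) m)) \<longlonglongrightarrow> (\<Sum>m\<in>F. norm (coef (X i) m - f m))"
      by (intro tendsto_intros f)
    have "(\<Sum>m\<in>F. norm (coef (X i) m - coef (X j) m)) \<le> e" if "j \<ge> N" for j
    proof -
      have "(\<Sum>m\<in>F. norm (coef (X i - X j) m)) \<le> norm (X i - X j)"
        unfolding norm_ell1.rep_eq using \<open>finite F\<close> by (intro finite_sum_le_infsum coef_summable) auto
      then show ?thesis using N that \<open>i \<ge> N\<close> by (force simp: minus_ell1.rep_eq)
    qed
    then show "\<forall>\<^sub>F j in sequentially. (\<Sum>m\<in>F. norm (coef (X i) m - coef (X j) m)) \<le> e"
      by (auto simp: eventually_sequentially)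
  qed auto
  have summ: "(\<lambda>m. norm (coef (X i) m - f m)) summable_on UNIV"
    if N: "\<forall>i\<ge>N. \<forall>j\<ge>N. norm (X i - X j) < e" and "i \<ge> N" for N e i
    using fin[OF that] by (intro nonneg_bdd_above_summable_on) (auto intro!: bdd_aboveI2)
  obtain N1 where N1: "\<forall>i\<ge>N1. \<forall>j\<ge>N1. norm (X i - X j) < 1" using C[of 1] by auto
  have "(\<lambda>m. norm (f m)) summable_on UNIV"
  proof (rule summable_on_comparison_test)
    show "(\<lambda>m. norm (coef (X N1) m) + norm (coef (X N1) m - f m)) summable_on UNIV"
      by (intro summable_on_add coef_summable summ[OF N1]) auto
    show "norm (f m) \<le> norm (coef (X N1) m) + norm (coef (X N1) m - f m)" for m
      using norm_triangle_sub[of "f m" "coef (X N1) m"] by (simp add: norm_minus_commute)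
  qed auto
  then have Ff: "coef (Ell1 f) = f" by (simp add: Ell1_inverse)
  have "X \<longlonglongrightarrow> Ell1 f"
  proof (rule LIMSEQ_I)
    fix r :: real assume "r > 0"
    obtain N where N: "\<forall>i\<ge>N. \<forall>j\<ge>N. norm (X i - X j) < r / 2" using C[of "r/2"] \<open>r > 0\<close> by auto
    have "norm (X i - Ell1 f) < r" if "i \<ge> N" for i
    proof -
      have "norm (X i - Ell1 f) \<le> r / 2"
        unfolding norm_ell1.rep_eq minus_ell1.rep_eq Ff
        by (intro infsum_le_finite_sums summ[OF N that] fin[OF N that]) auto
      then show ?thesis using \<open>r > 0\<close> by simp
    qed
    then show "\<exists>N. \<forall>i\<ge>N. norm (X i - Ell1 f) < r" by blast
  qed
  then show ?thesis ..
qed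

instance ell1 :: banach
  by standard (auto simp: convergent_def intro: ell1_Cauchy_convergent)

section \<open>Evaluation in the closed unit polydisc and linear coefficients\<close>

lemma ps_monom_superset:
  assumes "finite K" "Poly_Mapping.keys m \<subseteq> K"
  shows "ps_monom a m = (\<Prod>v\<in>K. a v ^ Poly_Mapping.lookup m v)"
  unfolding ps_monom_def
  by (rule prod.mono_neutral_left) (use assms in \<open>auto simp: in_keys_iff\<close>)

lemma ps_monom_add: "ps_monom a (m + n) = ps_monom a m * ps_monom a n"
proof -
  let ?K = "Poly_Mapping.keys m \<union> Poly_Mapping.keys n"
  have "finite ?K" "Poly_Mapping.keys (m + n) \<subseteq> ?K" using Poly_Mapping.keys_add[of m n] by auto
  then show ?thesis
    by (simp add: ps_monom_superset[of ?K] lookup_add power_add prod.distrib)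
qed

lemma ps_monom_0 [simp]: "ps_monom a 0 = 1"
  by (simp add: ps_monom_def)

lemma ps_monom_single [simp]: "ps_monom a (Poly_Mapping.single v 1) = a v"
  by (simp add: ps_monom_def)

lemma norm_ps_monom_le:
  assumes "\<And>v. v \<in> Poly_Mapping.keys m \<Longrightarrow> norm (a v) \<le> 1" shows "norm (ps_monom a m) \<le> 1"
  unfolding ps_monom_def prod_norm[symmetric]
  by (rule prod_le_1) (use assms in \<open>auto simp: norm_power intro: power_le_one\<close>)

lemma ps_mult_times_monom:
  "ps_mult (\<lambda>m. f m * ps_monom a m) (\<lambda>m. g m * ps_monom a m) m = ps_mult f g m * ps_monom a m"
  unfolding ps_mult_def sum_distrib_right
  by (rule sum.cong) (auto simp: ps_monom_add)

context
  fixes a :: "nat \<times> nat \<Rightarrow> complex"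
  assumes a: "\<And>v. norm (a v) \<le> 1"
begin

lemma ps_eval_summable: "(\<lambda>m. norm (coef f m * ps_monom a m)) summable_on UNIV"
  by (rule summable_on_comparison_test[OF coef_summable[of f]])
     (auto simp: norm_mult intro!: norm_ps_monom_le a mult_left_le)

lemma norm_ps_eval_le: "norm (ps_eval (coef f) a) \<le> norm f"
  unfolding ps_eval_def norm_ell1.rep_eq
  by (rule norm_infsum_le[OF has_sum_infsum[OF abs_summable_summable[OF ps_eval_summable]]
        has_sum_infsum[OF coef_summable]])
     (auto simp: norm_mult intro!: norm_ps_monom_le a mult_left_le)

lemma ps_eval_mult: "ps_eval (coef (f * g)) a = ps_eval (coef f) a * ps_eval (coef g) a"
  unfolding ps_eval_def times_ell1.rep_eq
  using ps_mult_has_sum[OF ps_eval_summable[of f] ps_eval_summable[of g]]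
  by (simp add: has_sum_iff ps_mult_times_monom[abs_def])

lemma bounded_linear_ps_eval: "bounded_linear (\<lambda>f. ps_eval (coef f) a)"
proof (rule bounded_linear_intro[where K = 1])
  note s = abs_summable_summable[OF ps_eval_summable]
  show "ps_eval (coef (f + g)) a = ps_eval (coef f) a + ps_eval (coef g) a" for f g
    using infsum_add[OF s[of f] s[of g]] by (simp add: ps_eval_def plus_ell1.rep_eq algebra_simps)
  show "ps_eval (coef (r *\<^sub>R f)) a = r *\<^sub>R ps_eval (coef f) a" for r f
    by (simp add: ps_eval_def scaleR_ell1.rep_eq infsum_scaleR_right flip: scaleR_scaleR)
  show "norm (ps_eval (coef f) a) \<le> norm f * 1" for f using norm_ps_eval_le[of f] by simp
qed

end

lemma ps_eval_delta: "ps_eval (coef (ell1_delta k c)) a = c * ps_monom a k"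
proof -
  have "ps_eval (coef (ell1_delta k c)) a = infsum (\<lambda>m. c * ps_monom a k) {k}"
    unfolding ps_eval_def ell1_delta.rep_eq by (rule infsum_cong_neutral) auto
  then show ?thesis by simp
qed

lemma ell1_delta_0_mult: "ell1_delta 0 c * ell1_delta k d = ell1_delta k (c * d)"
  by transfer (auto simp: ps_mult_const fun_eq_iff)

lemma ell1_delta_0_1: "ell1_delta 0 1 = 1"
  by transfer auto

lemma bounded_linear_coef: "bounded_linear (\<lambda>f. coef f m)"
  by (rule bounded_linear_intro[where K = 1])
     (auto simp: plus_ell1.rep_eq scaleR_ell1.rep_eq norm_coef_le)

lemma single_decompositions:
  "{(m1 :: mon, m2). m1 + m2 = Poly_Mapping.single v 1} = {(0, Poly_Mapping.single v 1), (Poly_Mapping.single v 1, 0)}"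
proof -
  let ?s = "Poly_Mapping.single v 1 :: mon"
  have z: "m1 = 0 \<and> m2 = ?s \<or> m1 = ?s \<and> m2 = 0" if eq: "m1 + m2 = ?s" for m1 m2 :: mon
  proof -
    have l: "Poly_Mapping.lookup m1 w + Poly_Mapping.lookup m2 w = (if w = v then 1 else 0)" for w
      using arg_cong[OF eq, of "\<lambda>m. Poly_Mapping.lookup m w"] by (simp add: lookup_add lookup_single when_def)
    consider "Poly_Mapping.lookup m1 v = 0" | "Poly_Mapping.lookup m2 v = 0" using l[of v] by (simp add: add_is_1, meson)
    then show ?thesis
    proof cases
      case 1
      then have "m1 = 0" using l by (intro poly_mapping_eqI) (metis add_is_0 lookup_zero)
      then show ?thesis using eq by simp
    next
      case 2
      then have "m2 = 0" using l by (intro poly_mapping_eqI) (metis add_is_0 lookup_zero)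
      then show ?thesis using eq by simp
    qed
  qed
  show ?thesis using z by (fastforce simp del: One_nat_def)
qed

text \<open>A monomial of degree one factors only trivially, so its coefficient obeys the Leibniz
  rule at the origin.\<close>

lemma coef_mult_single:
  "coef (f * g) (Poly_Mapping.single v 1)
     = coef f (Poly_Mapping.single v 1) * coef g 0 + coef f 0 * coef g (Poly_Mapping.single v 1)"
proof -
  have "(0 :: mon) \<noteq> Poly_Mapping.single v 1" using lookup_single_eq[of v "1::nat"] by (auto simp del: lookup_single_eq)
  then show ?thesis
    unfolding times_ell1.rep_eq ps_mult_def single_decompositions by (subst sum.insert) (auto simp: add.commute)
qed

section \<open>Resonant periodic orbits as fixed points\<close>

text \<open>The unknowns are treated together as one bounded sequence: in the closed ball of radius
  \<open>c\<close> for the supremum norm, \<open>G\<close> is a contraction with constant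
  1/2.\<close>

lemma contraction_family:
  fixes G :: "(nat \<Rightarrow> 'b::banach) \<Rightarrow> nat \<Rightarrow> 'b"
  assumes "0 \<le> c"
    and self: "\<And>x k. (\<And>k. norm (x k) \<le> c) \<Longrightarrow> norm (G x k) \<le> c"
    and contr: "\<And>x y D k. (\<And>k. norm (x k) \<le> c) \<Longrightarrow> (\<And>k. norm (y k) \<le> c) \<Longrightarrow>
                   (\<And>k. norm (x k - y k) \<le> D) \<Longrightarrow> norm (G x k - G y k) \<le> D / 2"
  shows "\<exists>!x. (\<forall>k. norm (x k) \<le> c) \<and> G x = x"
proof -
  define S :: "(nat \<Rightarrow>\<^sub>C 'b) set" where "S = cball 0 c"
  define F :: "(nat \<Rightarrow>\<^sub>C 'b) \<Rightarrow> (nat \<Rightarrow>\<^sub>C 'b)" where "F = (\<lambda>x. Bcontfun (G (apply_bcontfun x)))"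
  have S_iff: "x \<in> S \<longleftrightarrow> (\<forall>k. norm (apply_bcontfun x k) \<le> c)" for x
    unfolding S_def using norm_bound[of x c] norm_bounded[of x] by (auto intro: order_trans)
  have bc: "apply_bcontfun (Bcontfun x) = x" if "\<And>k. norm (x k) \<le> c" for x :: "nat \<Rightarrow> 'b"
    using that by (intro Bcontfun_inverse bcontfun_normI) auto
  have F: "apply_bcontfun (F x) = G (apply_bcontfun x)" if "x \<in> S" for x
    unfolding F_def using that by (intro bc self) (auto simp: S_iff)
  have ex1: "\<exists>!x\<in>S. F x = x"
  proof (rule Banach_fix[where c = "1/2"])
    \<comment> \<open>The library has completeness of bounded continuous functions only over metric spaces,
      and \<open>nat\<close> is not an instance.\<close>
    show "complete S"
    proof (rule completeI)
      fix f assume f: "\<forall>n. f n \<in> S" and "Cauchy f"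
      have "uniformly_Cauchy_on UNIV (\<lambda>n. apply_bcontfun (f n))"
      proof (rule uniformly_Cauchy_onI)
        fix e :: real assume "0 < e"
        then show "\<exists>M. \<forall>k\<in>UNIV. \<forall>m\<ge>M. \<forall>n\<ge>M. dist (apply_bcontfun (f m) k) (apply_bcontfun (f n) k) < e"
          using \<open>Cauchy f\<close> dist_bounded unfolding Cauchy_def by (meson le_less_trans)
      qed
      then obtain g where "uniform_limit UNIV f g sequentially"
        using Cauchy_uniformly_convergent uniformly_convergent_on_def by blast
      from uniform_limit_bcontfunE[OF this sequentially_bot] obtain l where "f \<longlonglongrightarrow> l" by metis
      moreover from this have "l \<in> S"
        by (rule closed_sequentially[rotated 2]) (use f in \<open>auto simp: S_def\<close>)
      ultimately show "\<exists>l\<in>S. f \<longlonglongrightarrow> l" by blast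
    qed
    show "S \<noteq> {}" unfolding S_def using \<open>0 \<le> c\<close> by auto
    show "F ` S \<subseteq> S" using self by (auto simp: S_iff F)
    show "dist (F x) (F y) \<le> 1/2 * dist x y" if "x \<in> S" "y \<in> S" for x y
    proof (rule dist_bound)
      fix k
      show "dist (apply_bcontfun (F x) k) (apply_bcontfun (F y) k) \<le> 1/2 * dist x y"
        using contr[of "apply_bcontfun x" "apply_bcontfun y" "dist x y" k] that dist_bounded[of x _ y]
        by (auto simp: F S_iff dist_norm)
    qed
  qed auto
  then obtain x where x: "x \<in> S" "F x = x" and u: "\<And>y. y \<in> S \<Longrightarrow> F y = y \<Longrightarrow> y = x" by blast
  show ?thesis
  proof (rule ex1I[of _ "apply_bcontfun x"])
    show "(\<forall>k. norm (apply_bcontfun x k) \<le> c) \<and> G (apply_bcontfun x) = apply_bcontfun x"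
      using x F[of x] by (auto simp: S_iff)
    fix y assume y: "(\<forall>k. norm (y k) \<le> c) \<and> G y = y"
    then have b: "apply_bcontfun (Bcontfun y) = y" by (intro bc) auto
    have "Bcontfun y \<in> S" using y by (auto simp: S_iff b)
    moreover have "F (Bcontfun y) = Bcontfun y" using y by (simp add: F_def b)
    ultimately show "y = apply_bcontfun x" using u b by metis
  qed
qed

text \<open>
  With \<open>w = 2 \<pi> p / q\<close>, the orbit has radius \<open>r exp (h / (2 s))\<close> and its \<open>m\<close>-th point has angle
  \<open>th + m w + d m\<close>. \<open>J\<close> plays the role of the imaginary unit, so that \<open>rs_point\<close> is the point with angle
  \<open>t + e\<close>, and \<open>rs_twist\<close> is the excess of its rotation under \<open>T\<close> over \<open>w\<close>. The constant is twice the
  Lipschitz constant of \<open>dser\<close> at radius \<open>3 r\<close>, times the Lipschitz constant \<open>9 r\<close> of \<open>rs_point\<close>, divided by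
  \<open>r^(2 s + 1)\<close>.
\<close>

definition rs_const :: "nat \<Rightarrow> real" where
  "rs_const s = 18 * 16 ^ (s + 1) * 9 ^ s"

definition rs_point :: "nat \<Rightarrow> real \<Rightarrow> 'b \<Rightarrow> real \<Rightarrow> 'b \<Rightarrow> 'b \<Rightarrow> 'b::{real_normed_algebra_1,comm_ring_1,banach}" where
  "rs_point s r J t h e = r *\<^sub>R (exp (t *\<^sub>R J) * exp ((1 / (2 * real s)) *\<^sub>R h + J * e))"

definition rs_twist :: "nat \<Rightarrow> real \<Rightarrow> 'b \<Rightarrow> 'b::{real_normed_algebra_1,comm_ring_1,banach}" where
  "rs_twist s r h = r ^ (2 * s) *\<^sub>R (exp h - 1)"

text \<open>\<open>r_small\<close> keeps one kick below 1/16 of the unit \<open>r^(2 s)\<close> of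
  twist. \<open>q_r\<close> bounds \<open>q\<close> such units by 1, so the kicks accumulated over a
  whole period remain small, however large \<open>q\<close> is.\<close>

locale rs_data =
  fixes s q :: nat and r :: real
  assumes s_pos: "0 < s" and q_pos: "0 < q" and r_pos: "0 < r"
    and r_small: "rs_const s * r \<le> 1/16" and q_r: "real q * r ^ (2 * s) \<le> 1"

text \<open>\<open>exp_J\<close> is required in addition to \<open>J_le\<close> because angles grow
  along the orbit; the norm of \<open>J\<close> alone would only bound the exponential by
  \<open>exp \<bar>t\<bar>\<close>.\<close>

locale rs_system = rs_data s q r for s q :: nat and r :: real +
  fixes w th :: real and J :: "'b::{real_normed_algebra_1,comm_ring_1,banach}" and X :: "nat \<times> nat \<Rightarrow> 'b"
  assumes X_le: "\<And>v. norm (X v) \<le> 1" and J_le: "norm J \<le> 1" and exp_J: "\<And>t. norm (exp (t *\<^sub>R J)) \<le> 1"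
begin

text \<open>Both kicks of step \<open>m\<close> act after its rotation by \<open>w\<close>, hence
  \<open>m + 1\<close>.\<close>

definition angle :: "nat \<Rightarrow> real" where "angle m = th + (real m + 1) * w"

text \<open>The two extra rotations in one step: the series at the point after \<open>T\<close>, and
  the series at the conjugate of the next point, which comes from
  \<open>\<tau> \<circ> \<phi>\<^sub>a\<^sup>-\<^sup>1 \<circ> \<tau>\<close>. The second one
  involves \<open>d (Suc m)\<close>, so the recursion along the orbit is implicit.\<close>

definition kick :: "'b \<Rightarrow> (nat \<Rightarrow> 'b) \<Rightarrow> nat \<Rightarrow> 'b" where
  "kick h d m =
     dser (2 * s) X (rs_point s r J (angle m) h (d m + rs_twist s r h))
                    (rs_point s r J (- angle m) h (- (d m + rs_twist s r h)))
   + dser (2 * s) X (rs_point s r J (- angle m) h (- d (Suc m))) (rs_point s r J (angle m) h (d (Suc m)))"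

text \<open>
  An orbit satisfies \<open>d (m + 1) = d m + rs_twist + kick m\<close> and closes up if \<open>d q = d 0 = 0\<close>; summing over the
  orbit determines the twist, which is \<open>shift\<close>. The radius is then found from \<open>rs_twist s r h = shift\<close>, that is
  \<open>exp h - 1 = shift / r^(2 s)\<close>.
\<close>

definition shift :: "'b \<Rightarrow> (nat \<Rightarrow> 'b) \<Rightarrow> 'b" where
  "shift h d = - ((1 / real q) *\<^sub>R (\<Sum>m<q. kick h d m))"

definition next_h :: "'b \<Rightarrow> (nat \<Rightarrow> 'b) \<Rightarrow> 'b" where
  "next_h h d = h - (exp h - 1) + (1 / r ^ (2 * s)) *\<^sub>R shift h d"

text \<open>The choice of \<open>shift\<close> makes the value at \<open>m = q\<close> vanish, which
  closes the orbit. The value 0 beyond \<open>q\<close> pins the remaining entries, so that the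
  infinite sequence is unique.\<close>

definition next_d :: "'b \<Rightarrow> (nat \<Rightarrow> 'b) \<Rightarrow> nat \<Rightarrow> 'b" where
  "next_d h d m = (if m \<le> q then real m *\<^sub>R shift h d + (\<Sum>l<m. kick h d l) else 0)"

definition solution :: "'b \<Rightarrow> (nat \<Rightarrow> 'b) \<Rightarrow> bool" where
  "solution h d \<longleftrightarrow> norm h \<le> 1/4 \<and> (\<forall>m. norm (d m) \<le> 1/4) \<and> next_h h d = h \<and> next_d h d = d"

section \<open>The contraction estimates\<close>

lemma rs_const_ge: "rs_const s \<ge> 18"
proof -
  have "(18::real) * 1 * 1 \<le> 18 * 16 ^ (s + 1) * 9 ^ s" by (intro mult_mono one_le_power) auto
  then show ?thesis by (simp add: rs_const_def)
qed

lemma r_le: "3 * r \<le> 1/4"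
proof -
  have "18 * r \<le> rs_const s * r" using rs_const_ge r_pos by (intro mult_right_mono) auto
  then show ?thesis using r_small by simp
qed

lemma r_pow_le: "r ^ (2 * s) \<le> 1/3"
proof -
  have "r ^ (2 * s) \<le> r ^ 1" using r_pos r_le s_pos by (intro power_decreasing) auto
  then show ?thesis using r_le by simp
qed

lemma exp_quarter: "exp (1/4) - 1 \<le> (1/3 :: real)"
  using exp_bound[of "1/4"] by (simp add: power2_eq_square)

lemma point_bound:
  assumes "norm h \<le> 1/4" "norm e \<le> 1/2"
  shows "norm (rs_point s r J t h e) \<le> 3 * r"
    and "norm ((1 / (2 * real s)) *\<^sub>R h + J * e) \<le> 1"
proof -
  have "norm ((1 / (2 * real s)) *\<^sub>R h) \<le> 1/2 * (1/4)"
    unfolding norm_scaleR using s_pos assms by (intro mult_mono) (auto simp: field_simps)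
  moreover have "norm (J * e) \<le> 1 * (1/2)"
    using J_le assms by (intro order_trans[OF norm_mult_ineq] mult_mono) auto
  ultimately show A: "norm ((1 / (2 * real s)) *\<^sub>R h + J * e) \<le> 1"
    by (intro norm_triangle_le) simp
  have "norm (exp ((1 / (2 * real s)) *\<^sub>R h + J * e)) \<le> 3"
    by (rule order_trans[OF norm_exp order_trans[OF _ exp_le]]) (use A in simp)
  then have "norm (exp (t *\<^sub>R J) * exp ((1 / (2 * real s)) *\<^sub>R h + J * e)) \<le> 1 * 3"
    by (intro order_trans[OF norm_mult_ineq] mult_mono exp_J) auto
  then show "norm (rs_point s r J t h e) \<le> 3 * r"
    using r_pos by (simp add: rs_point_def)
qed

lemma point_lipschitz:
  assumes "norm h \<le> 1/4" "norm e \<le> 1/2" "norm h' \<le> 1/4" "norm e' \<le> 1/2"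
    and D: "norm (h - h') \<le> D" "norm (e - e') \<le> 2 * D"
  shows "norm (rs_point s r J t h e - rs_point s r J t h' e') \<le> 9 * r * D"
proof -
  have D0: "0 \<le> D" using D norm_ge_zero order_trans by blast
  let ?A = "\<lambda>h e. (1 / (2 * real s)) *\<^sub>R h + J * e"
  have "?A h e - ?A h' e' = (1 / (2 * real s)) *\<^sub>R (h - h') + J * (e - e')"
    by (simp add: algebra_simps)
  also have "norm \<dots> \<le> 1 * D + 1 * (2 * D)"
  proof (rule norm_triangle_le, rule add_mono)
    show "norm ((1 / (2 * real s)) *\<^sub>R (h - h')) \<le> 1 * D"
      unfolding norm_scaleR using s_pos D by (intro mult_mono) (auto simp: field_simps)
    show "norm (J * (e - e')) \<le> 1 * (2 * D)"
      using J_le D by (intro order_trans[OF norm_mult_ineq] mult_mono) auto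
  qed
  finally have dA: "norm (?A h e - ?A h' e') \<le> 3 * D" by simp
  have "norm (exp (?A h e) - exp (?A h' e')) \<le> exp 1 * norm (?A h e - ?A h' e')"
    by (intro norm_exp_diff_le point_bound assms)
  also have "\<dots> \<le> 3 * (3 * D)" using dA exp_le by (intro mult_mono) auto
  finally have "norm (exp (t *\<^sub>R J) * (exp (?A h e) - exp (?A h' e'))) \<le> 1 * (3 * (3 * D))"
    by (intro order_trans[OF norm_mult_ineq] mult_mono exp_J) auto
  then have "r * norm (exp (t *\<^sub>R J) * (exp (?A h e) - exp (?A h' e'))) \<le> r * (9 * D)"
    using r_pos by (intro mult_left_mono) auto
  then show ?thesis
    using r_pos by (simp add: rs_point_def right_diff_distrib flip: scaleR_right_diff_distrib)
qed

lemma twist_lipschitz: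
  assumes "norm h \<le> 1/4" "norm h' \<le> 1/4"
  shows "norm (rs_twist s r h - rs_twist s r h') \<le> norm (h - h')"
proof -
  have "rs_twist s r h - rs_twist s r h' = r ^ (2 * s) *\<^sub>R (exp h - exp h')"
    by (simp add: rs_twist_def flip: scaleR_right_diff_distrib)
  also have "norm \<dots> \<le> 1/3 * (exp (1/4) * norm (h - h'))"
    unfolding norm_scaleR using r_pow_le r_pos by (intro mult_mono norm_exp_diff_le assms) auto
  also have "\<dots> \<le> 1/3 * (3 * norm (h - h'))"
    using exp_quarter by (intro mult_left_mono mult_right_mono) auto
  finally show ?thesis by simp
qed

lemma twist_bound: "norm h \<le> 1/4 \<Longrightarrow> norm (rs_twist s r h) \<le> 1/4"
  using twist_lipschitz[of h 0] by (simp add: rs_twist_def)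

lemma
  assumes x: "norm h \<le> 1/4" "\<And>m. norm (d m) \<le> 1/4"
  shows kick_bound: "norm (kick h d m) \<le> rs_const s * r ^ (2 * s + 1)"
    and kick_lipschitz: "\<lbrakk>norm h' \<le> 1/4; \<And>m. norm (d' m) \<le> 1/4; norm (h - h') \<le> D; \<And>m. norm (d m - d' m) \<le> D\<rbrakk>
        \<Longrightarrow> norm (kick h d m - kick h' d' m) \<le> rs_const s * r ^ (2 * s + 1) * D"
proof -
  have e: "norm (d m + rs_twist s r h) \<le> 1/2" "norm (d (Suc m)) \<le> 1/2"
    if "norm h \<le> 1/4" "\<And>m. norm (d m) \<le> 1/4" for h d m
    using norm_triangle_ineq[of "d m" "rs_twist s r h"] that(2)[of m] that(2)[of "Suc m"] twist_bound[OF that(1)]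
    by auto
  have pow: "4 ^ (2 * s + 2) * (3 * r) ^ (2 * s) = 16 ^ (s + 1) * 9 ^ s * r ^ (2 * s)"
    by (simp add: power_mult power_mult_distrib)
  have "norm (kick h d m) \<le> 4 ^ (2 * s + 2) * (3 * r) ^ (2 * s + 1) + 4 ^ (2 * s + 2) * (3 * r) ^ (2 * s + 1)"
    unfolding kick_def
    by (rule norm_triangle_le, rule add_mono; intro dser_norm_le point_bound X_le r_le) (use x e[of h d m] in \<open>auto simp only: norm_minus_cancel\<close>)
  also have "\<dots> = 2 * (3 * r) * (4 ^ (2 * s + 2) * (3 * r) ^ (2 * s))" by simp
  also have "\<dots> = 1/3 * rs_const s * r ^ (2 * s + 1)"
    unfolding pow rs_const_def by simp
  also have "\<dots> \<le> 1 * rs_const s * r ^ (2 * s + 1)"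
    using rs_const_ge r_pos by (intro mult_right_mono) auto
  finally show "norm (kick h d m) \<le> rs_const s * r ^ (2 * s + 1)" by simp
  assume x': "norm h' \<le> 1/4" "\<And>m. norm (d' m) \<le> 1/4"
    and D: "norm (h - h') \<le> D" "\<And>m. norm (d m - d' m) \<le> D"
  have D0: "0 \<le> D" using D norm_ge_zero order_trans by blast
  have dm: "norm ((d m + rs_twist s r h) - (d' m + rs_twist s r h')) \<le> 2 * D"
    using norm_triangle_ineq[of "d m - d' m" "rs_twist s r h - rs_twist s r h'"] D(2)[of m]
      twist_lipschitz[OF x(1) x'(1)] D(1) by (simp add: algebra_simps)
  have dm': "norm (- (d m + rs_twist s r h) - - (d' m + rs_twist s r h')) \<le> 2 * D"
    using dm by (metis minus_diff_minus norm_minus_cancel)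
  have dS: "norm (d (Suc m) - d' (Suc m)) \<le> 2 * D" using D(2)[of "Suc m"] D0 by simp
  have dS': "norm (- d (Suc m) - - d' (Suc m)) \<le> 2 * D"
    using dS by (metis minus_diff_minus norm_minus_cancel)
  have "norm (kick h d m - kick h' d' m)
      \<le> 4 ^ (2 * s + 2) * (3 * r) ^ (2 * s) * (9 * r * D) + 4 ^ (2 * s + 2) * (3 * r) ^ (2 * s) * (9 * r * D)"
    unfolding kick_def add_diff_add
    by (rule norm_triangle_le, rule add_mono; intro dser_lipschitz point_bound point_lipschitz X_le r_le)
       (use x e[of h d m] x' e[of h' d' m] D(1) dm dm' dS dS' in \<open>auto simp only: norm_minus_cancel\<close>)
  also have "\<dots> = rs_const s * r ^ (2 * s + 1) * D"
    unfolding pow rs_const_def by simp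
  finally show "norm (kick h d m - kick h' d' m) \<le> rs_const s * r ^ (2 * s + 1) * D" .
qed

lemma const_r_pow: "rs_const s * r ^ (2 * s + 1) \<le> 1/16 * r ^ (2 * s)"
  using mult_right_mono[OF r_small, of "r ^ (2 * s)"] r_pos by (simp add: ac_simps)

text \<open>The factor \<open>c\<close> treats two cases at once: \<open>c = 0\<close> gives bounds
  and \<open>c = 1\<close> gives Lipschitz estimates. At most \<open>q\<close> kicks are added, and
  \<open>q * r ^ (2 * s)\<close> is at most 1, so the kicks and the shifts contribute
  \<open>D / 16\<close> each.\<close>

lemma
  assumes kick: "\<And>m. norm (kick h d m - c * kick h' d' m) \<le> 1/16 * r ^ (2 * s) * D" and D: "0 \<le> D"
  shows shift_close: "norm (shift h d - c * shift h' d') \<le> 1/16 * r ^ (2 * s) * D"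
    and next_d_close: "norm (next_d h d m - c * next_d h' d' m) \<le> 1/8 * D"
proof -
  let ?b = "1/16 * r ^ (2 * s) * D"
  have sum: "norm ((\<Sum>l<m. kick h d l) - c * (\<Sum>l<m. kick h' d' l)) \<le> real m * ?b" for m
  proof -
    have "norm (\<Sum>l<m. kick h d l - c * kick h' d' l) \<le> (\<Sum>l<m. ?b)"
      by (intro sum_norm_le kick)
    then show ?thesis by (simp add: sum_subtractf sum_distrib_left)
  qed
  have "shift h d - c * shift h' d' = - ((1 / real q) *\<^sub>R ((\<Sum>l<q. kick h d l) - c * (\<Sum>l<q. kick h' d' l)))"
    by (simp add: shift_def algebra_simps)
  also have "norm \<dots> \<le> 1 / real q * (real q * ?b)"
    unfolding norm_minus_cancel norm_scaleR using q_pos by (intro mult_mono sum) auto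
  finally show sh: "norm (shift h d - c * shift h' d') \<le> ?b" using q_pos by simp
  show "norm (next_d h d m - c * next_d h' d' m) \<le> 1/8 * D"
  proof (cases "m \<le> q")
    case True
    have "next_d h d m - c * next_d h' d' m
        = real m *\<^sub>R (shift h d - c * shift h' d') + ((\<Sum>l<m. kick h d l) - c * (\<Sum>l<m. kick h' d' l))"
      using True by (simp add: next_d_def algebra_simps)
    also have "norm \<dots> \<le> real m * ?b + real m * ?b"
      using mult_left_mono[OF sh, of "real m"]
      by (intro norm_triangle_le add_mono sum) (simp only: norm_scaleR abs_of_nat)
    also have "\<dots> = 1/8 * (real m * r ^ (2 * s)) * D" by simp
    also have "\<dots> \<le> 1/8 * (real q * r ^ (2 * s)) * D"
      using True r_pos D by (intro mult_right_mono mult_left_mono) auto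
    also have "\<dots> \<le> 1/8 * 1 * D" using q_r D by (intro mult_right_mono mult_left_mono) auto
    finally show ?thesis by simp
  next
    case False
    then show ?thesis using D by (simp add: next_d_def)
  qed
qed

lemma next_bound:
  assumes x: "norm h \<le> 1/4" "\<And>m. norm (d m) \<le> 1/4"
  shows "norm (next_h h d) \<le> 1/4" and "norm (next_d h d m) \<le> 1/4"
proof -
  have k: "norm (kick h d m - 0 * kick h d m) \<le> 1/16 * r ^ (2 * s) * 1" for m
    using kick_bound[of h d m, OF x] const_r_pow by simp
  have sh: "norm (shift h d) \<le> 1/16 * r ^ (2 * s)"
    using shift_close[of h d 0 h d 1, OF k] by simp
  show "norm (next_d h d m) \<le> 1/4" using next_d_close[of h d 0 h d 1 m, OF k] by simp
  have "norm (h - (exp h - 1)) \<le> (exp (1/4) - 1) * norm h"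
    using norm_exp_diff_sub_le[OF x(1), of 0] norm_minus_commute[of "exp h - h" 1] by (simp add: algebra_simps)
  also have "\<dots> \<le> 1/3 * (1/4)" using exp_quarter x by (intro mult_mono) auto
  finally have a: "norm (h - (exp h - 1)) \<le> 1/12" by simp
  have "norm ((1 / r ^ (2 * s)) *\<^sub>R shift h d) \<le> 1/16"
    using sh r_pos by (simp add: field_simps)
  with a show "norm (next_h h d) \<le> 1/4"
    unfolding next_h_def by (intro norm_triangle_le) simp
qed

lemma next_lipschitz:
  assumes x: "norm h \<le> 1/4" "\<And>m. norm (d m) \<le> 1/4"
    and x': "norm h' \<le> 1/4" "\<And>m. norm (d' m) \<le> 1/4"
    and D: "norm (h - h') \<le> D" "\<And>m. norm (d m - d' m) \<le> D"
  shows "norm (next_h h d - next_h h' d') \<le> D / 2" and "norm (next_d h d m - next_d h' d' m) \<le> D / 2"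
proof -
  have D0: "0 \<le> D" using D norm_ge_zero order_trans by blast
  have k: "norm (kick h d m - 1 * kick h' d' m) \<le> 1/16 * r ^ (2 * s) * D" for m
    using kick_lipschitz[of h d h' d' D m, OF x x' D] mult_right_mono[OF const_r_pow D0] by simp
  have sh: "norm (shift h d - shift h' d') \<le> 1/16 * r ^ (2 * s) * D"
    using shift_close[of h d 1 h' d' D, OF k D0] by simp
  show "norm (next_d h d m - next_d h' d' m) \<le> D / 2" using next_d_close[of h d 1 h' d' D m, OF k D0] D0 by simp
  have "norm ((h - (exp h - 1)) - (h' - (exp h' - 1))) = norm ((exp h - h) - (exp h' - h'))"
    by (subst norm_minus_commute) (simp add: algebra_simps)
  also have "\<dots> \<le> (exp (1/4) - 1) * norm (h - h')"
    by (rule norm_exp_diff_sub_le[OF x(1) x'(1)])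
  also have "\<dots> \<le> 1/3 * D" using exp_quarter D by (intro mult_mono) auto
  finally have a: "norm ((h - (exp h - 1)) - (h' - (exp h' - 1))) \<le> 1/3 * D" .
  have b: "norm ((1 / r ^ (2 * s)) *\<^sub>R (shift h d - shift h' d')) \<le> 1/16 * D"
    unfolding norm_scaleR using sh r_pos by (simp add: field_simps)
  have "next_h h d - next_h h' d'
      = ((h - (exp h - 1)) - (h' - (exp h' - 1))) + (1 / r ^ (2 * s)) *\<^sub>R (shift h d - shift h' d')"
    by (simp add: next_h_def algebra_simps)
  also have "norm \<dots> \<le> 1/3 * D + 1/16 * D" by (intro norm_triangle_le add_mono a b)
  finally show "norm (next_h h d - next_h h' d') \<le> D / 2" using D0 by simp
qed

lemma solution_ex1: "\<exists>!(h, d). solution h d"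
proof -
  \<comment> \<open>Coordinate 0 holds the radius unknown \<open>h\<close>, and coordinate
    \<open>Suc m\<close> holds \<open>d m\<close>.\<close>
  define G where "G = (\<lambda>x k. case k of 0 \<Rightarrow> next_h (x 0) (\<lambda>m. x (Suc m)) | Suc m \<Rightarrow> next_d (x 0) (\<lambda>m. x (Suc m)) m)"
  have "\<exists>!x. (\<forall>k. norm (x k) \<le> 1/4) \<and> G x = x"
    by (rule contraction_family)
       (auto simp: G_def next_bound[simplified] next_lipschitz[simplified] split: nat.split)
  then obtain x where x: "\<forall>k. norm (x k) \<le> 1/4" "G x = x"
    and u: "\<And>y. (\<forall>k. norm (y k) \<le> 1/4) \<Longrightarrow> G y = y \<Longrightarrow> y = x" by blast
  show ?thesis
  proof (rule ex1I[of _ "(x 0, \<lambda>m. x (Suc m))"])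
    show "case (x 0, \<lambda>m. x (Suc m)) of (h, d) \<Rightarrow> solution h d"
      using x(1) fun_cong[OF x(2), of 0] fun_cong[OF x(2), of "Suc _"]
      by (auto simp: solution_def G_def)
  next
    fix p assume "case p of (h, d) \<Rightarrow> solution h d"
    then obtain h d where p: "p = (h, d)" and s: "solution h d" by auto
    define y where "y = (\<lambda>k. case k of 0 \<Rightarrow> h | Suc m \<Rightarrow> d m)"
    have "y = x"
      by (rule u) (use s in \<open>auto simp: y_def G_def solution_def fun_eq_iff split: nat.split\<close>)
    then show "p = (x 0, \<lambda>m. x (Suc m))" by (auto simp: p y_def)
  qed
qed

lemma solution_unique: "solution h d \<Longrightarrow> solution h' d' \<Longrightarrow> h = h' \<and> d = d'"
  using solution_ex1 by blast

end

section \<open>Evaluation and the linear terms of the radius series\<close>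

text \<open>Continuous unital homomorphisms commute with convergent power series, so they transport
  the fixed-point equations from one algebra to another. The instances are the embedding of
  constants, evaluation at a point, and the constant term.\<close>

locale algebra_hom =
  fixes F :: "'b::{real_normed_algebra_1,comm_ring_1,banach} \<Rightarrow> 'c::{real_normed_algebra_1,comm_ring_1,banach}"
  assumes bounded_linear: "bounded_linear F"
    and mult: "F (x * y) = F x * F y" and one: "F 1 = 1"
begin

sublocale bounded_linear F by (rule bounded_linear)

lemma power: "F (x ^ n) = F x ^ n"
  by (induction n) (auto simp: mult one)

lemma exp: "F (exp x) = exp (F x)"
proof -
  have "(\<lambda>n. F (x ^ n /\<^sub>R fact n)) sums F (exp x)"
    by (rule bounded_linear.sums[OF bounded_linear exp_converges])
  then show ?thesis
    using exp_converges[of "F x"] by (simp add: scaleR power sums_unique2)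
qed

lemma dser:
  assumes "\<And>v. norm (X v) \<le> 1" "norm z \<le> 1/4" "norm w \<le> 1/4"
  shows "F (dser n X z w) = dser n (\<lambda>v. F (X v)) (F z) (F w)"
proof -
  have "((\<lambda>p. F (case p of (i, j) \<Rightarrow> X (i, j) * z ^ i * w ^ j)) has_sum F (dser n X z w)) {(i, j). n < i + j}"
    unfolding dser_def
    by (intro has_sum_bounded_linear[OF bounded_linear] has_sum_infsum
        dser_summable[where R = "1/4"]) (use assms in auto)
  then show ?thesis
    unfolding dser_def by (simp add: has_sum_iff case_prod_unfold mult power)
qed

end

locale rs_hom =
  A: rs_system s q r w th J X + B: rs_system s q r w th J' X' + algebra_hom F
  for s q :: nat and r w th :: real
    and J :: "'b::{real_normed_algebra_1,comm_ring_1,banach}" and X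
    and J' :: "'c::{real_normed_algebra_1,comm_ring_1,banach}" and X'
    and F :: "'b \<Rightarrow> 'c" +
  assumes norm_le: "norm (F x) \<le> norm x" and F_J: "F J = J'" and F_X: "F (X v) = X' v"
begin

lemma point: "F (rs_point s r J t h e) = rs_point s r J' t (F h) (F e)"
  by (simp add: rs_point_def scaleR mult exp add F_J)

lemma twist: "F (rs_twist s r h) = rs_twist s r (F h)"
  by (simp add: rs_twist_def scaleR exp diff one)

lemma kick:
  assumes x: "norm h \<le> 1/4" "\<And>m. norm (d m) \<le> 1/4"
  shows "F (A.kick h d m) = B.kick (F h) (\<lambda>m. F (d m)) m"
proof -
  have b: "norm (rs_point s r J t h e) \<le> 1/4" if "norm e \<le> 1/2" for t e
    using A.point_bound(1)[OF x(1) that] A.r_le by (rule order_trans)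
  have e: "norm (d m + rs_twist s r h) \<le> 1/2" "norm (d (Suc m)) \<le> 1/2"
    using norm_triangle_ineq[of "d m" "rs_twist s r h"] x(2)[of m] x(2)[of "Suc m"] A.twist_bound[OF x(1)]
    by auto
  have e': "norm (- (d m + rs_twist s r h)) \<le> 1/2" "norm (- d (Suc m)) \<le> 1/2"
    using e by (simp_all only: norm_minus_cancel)
  show ?thesis
    unfolding A.kick_def B.kick_def add
      dser[OF A.X_le b[OF e(1)] b[OF e'(1)]] dser[OF A.X_le b[OF e'(2)] b[OF e(2)]]
    by (simp add: point twist add neg diff F_X A.angle_def B.angle_def)
qed

text \<open>The equations are built from operations that \<open>F\<close> preserves, and
  \<open>norm_le\<close> keeps the image in the ball where solutions are unique.\<close>

lemma solution:
  assumes sol: "A.solution h d" shows "B.solution (F h) (\<lambda>m. F (d m))"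
proof -
  have x: "norm h \<le> 1/4" "\<And>m. norm (d m) \<le> 1/4" using sol by (auto simp: A.solution_def)
  have sh: "F (A.shift h d) = B.shift (F h) (\<lambda>m. F (d m))"
    by (simp add: A.shift_def B.shift_def neg scaleR sum kick[OF x])
  have "F (A.next_h h d) = B.next_h (F h) (\<lambda>m. F (d m))"
    by (simp add: A.next_h_def B.next_h_def add diff scaleR exp one sh)
  moreover have "F (A.next_d h d m) = B.next_d (F h) (\<lambda>m. F (d m)) m" for m
    by (simp add: A.next_d_def B.next_d_def add scaleR sum sh kick[OF x] zero)
  ultimately show ?thesis
    using sol norm_le unfolding A.solution_def B.solution_def
    by (metis (no_types, lifting) ext order_trans)
qed

end

section \<open>The radius as a formal power series\<close>

abbreviation ell1_J :: ell1 where "ell1_J \<equiv> ell1_delta 0 \<i>"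
definition ell1_X :: "nat \<times> nat \<Rightarrow> ell1" where "ell1_X v = ell1_delta (Poly_Mapping.single v 1) 1"

lemma norm_ell1_X: "norm (ell1_X v) = 1"
  by (simp add: ell1_X_def norm_ell1_delta)

lemma ps_eval_ell1_X: "ps_eval (coef (ell1_X v)) a = a v"
  unfolding ell1_X_def ps_eval_delta ps_monom_single by simp

definition rs_h :: "nat \<Rightarrow> nat \<Rightarrow> real \<Rightarrow> real \<Rightarrow> real \<Rightarrow> ell1" where
  "rs_h s q r w th = (THE h. \<exists>d. rs_system.solution s q r w th ell1_J ell1_X h d)"

lemma algebra_hom_const: "algebra_hom (ell1_delta 0)"
proof (rule algebra_hom.intro)
  show "bounded_linear (ell1_delta 0)"
  proof (rule bounded_linear_intro[where K = 1])
    show "ell1_delta 0 (x + y) = ell1_delta 0 x + ell1_delta 0 y" for x y by transfer auto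
    show "ell1_delta 0 (a *\<^sub>R x) = a *\<^sub>R ell1_delta 0 x" for a x by transfer auto
  qed (simp add: norm_ell1_delta)
qed (simp_all add: ell1_delta_0_mult ell1_delta_0_1)

lemma algebra_hom_ps_eval:
  assumes "\<And>v. norm (a v) \<le> 1" shows "algebra_hom (\<lambda>f. ps_eval (coef f) a)"
proof (rule algebra_hom.intro)
  show "bounded_linear (\<lambda>f. ps_eval (coef f) a)" by (rule bounded_linear_ps_eval[OF assms])
  show "ps_eval (coef (f * g)) a = ps_eval (coef f) a * ps_eval (coef g) a" for f g
    by (rule ps_eval_mult[OF assms])
  show "ps_eval (coef 1) a = 1" using ps_eval_delta[of 0 1 a] by (simp add: ell1_delta_0_1)
qed

lemma coef_0_eq_ps_eval: "coef f 0 = ps_eval (coef f) (\<lambda>_. 0)"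
proof -
  have "ps_eval (coef f) (\<lambda>_. 0) = infsum (\<lambda>m. coef f m) {0}"
    unfolding ps_eval_def
  proof (rule infsum_cong_neutral)
    fix m :: mon assume "m \<in> UNIV - {0}"
    then obtain v where "v \<in> Poly_Mapping.keys m" by (auto simp: poly_mapping_eq_iff fun_eq_iff in_keys_iff)
    then have "ps_monom (\<lambda>_. 0) m = 0"
      unfolding ps_monom_def by (intro prod_zero) (auto intro!: bexI[of _ v] simp: in_keys_iff simp del: split_paired_Ex)
    then show "coef f m * ps_monom (\<lambda>_. 0) m = 0" by simp
  qed auto
  then show ?thesis by simp
qed

lemma algebra_hom_coef_0: "algebra_hom (\<lambda>f. coef f 0)"
  unfolding coef_0_eq_ps_eval by (rule algebra_hom_ps_eval) auto

text \<open>By the Leibniz rule, powers \<open>y ^ n\<close> with \<open>n\<close> at least 2 have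
  no linear term when \<open>y\<close> has no constant term.\<close>

lemma coef_exp_single:
  assumes "coef y 0 = 0"
  shows "coef (exp y) (Poly_Mapping.single v 1) = coef y (Poly_Mapping.single v 1)"
proof -
  interpret C: algebra_hom "\<lambda>f. coef f 0" by (rule algebra_hom_coef_0)
  let ?L = "\<lambda>f. coef f (Poly_Mapping.single v 1)"
  interpret L: bounded_linear ?L by (rule bounded_linear_coef)
  have "?L (y ^ n /\<^sub>R fact n) = (if n = 1 then ?L y else 0)" for n
  proof (cases n)
    case 0
    have "?L 1 = 0" using coef_mult_single[of 1 1 v] by (simp add: C.one)
    then show ?thesis using 0 by (simp add: L.scaleR)
  next
    case (Suc m)
    have "?L (y ^ n) = ?L y * coef (y ^ m) 0 + coef y 0 * ?L (y ^ m)"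
      unfolding Suc power_Suc by (rule coef_mult_single)
    also have "\<dots> = ?L y * (0 ^ m)" by (simp add: assms C.power)
    finally have "?L (y ^ n) = (if n = 1 then ?L y else 0)" using Suc by (cases m) auto
    then show ?thesis by (auto simp: scaleR_ell1.rep_eq)
  qed
  then have "(\<lambda>n. if n = 1 then ?L y else 0) sums ?L (exp y)"
    using L.sums[OF exp_converges[of y]] by simp
  then show ?thesis using sums_single[of 1 "\<lambda>_. ?L y"] by (simp add: sums_unique2)
qed

text \<open>Each summand carries its own variable as a factor, so its linear part is that variable
  times the constant terms of \<open>z ^ i\<close> and \<open>w ^ j\<close>. Only the summand with
  index \<open>(N, 0)\<close> has the right variable.\<close>

lemma coef_dser_single:
  assumes z: "norm z \<le> 1/4" "norm w \<le> 1/4" and n: "n < N"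
  shows "coef (dser n ell1_X z w) (Poly_Mapping.single (N, 0) 1) = coef z 0 ^ N"
proof -
  interpret C: algebra_hom "\<lambda>f. coef f 0" by (rule algebra_hom_coef_0)
  let ?L = "\<lambda>f. coef f (Poly_Mapping.single (N, 0) 1)"
  have "((\<lambda>p. ?L (case p of (i, j) \<Rightarrow> ell1_X (i, j) * z ^ i * w ^ j)) has_sum ?L (dser n ell1_X z w)) {(i, j). n < i + j}"
    unfolding dser_def
    by (intro has_sum_bounded_linear[OF bounded_linear_coef] has_sum_infsum dser_summable[where R = "1/4"])
       (use z in \<open>auto simp: norm_ell1_X\<close>)
  moreover have "?L (ell1_X (i, j) * z ^ i * w ^ j) = (if (i, j) = (N, 0) then coef z 0 ^ N else 0)" for i j
  proof -
    have "inj (\<lambda>v :: nat \<times> nat. Poly_Mapping.single v (1::nat))" by (rule injI) (metis keys_single singleton_insert_inj_eq zero_neq_one)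
    then have inj: "(Poly_Mapping.single v (1::nat) = Poly_Mapping.single v' 1) = (v = v')" for v v' :: "nat \<times> nat"
      by (auto dest: injD)
    have nz: "(0 :: mon) \<noteq> Poly_Mapping.single v 1" for v
      using lookup_single_eq[of v "1::nat"] by (auto simp del: lookup_single_eq)
    have "?L (ell1_X (i, j) * (z ^ i * w ^ j)) = ?L (ell1_X (i, j)) * coef (z ^ i * w ^ j) 0"
      using nz[of "(i, j)"] by (simp only: coef_mult_single ell1_X_def ell1_delta.rep_eq) simp
    also have "\<dots> = (if (N, 0) = (i, j) then coef z 0 ^ i * coef w 0 ^ j else 0)"
      by (simp only: ell1_X_def ell1_delta.rep_eq inj C.mult C.power) simp
    finally show ?thesis by (auto simp: mult.assoc)
  qed
  ultimately have "((\<lambda>p. if p = (N, 0) then coef z 0 ^ N else 0) has_sum ?L (dser n ell1_X z w)) {(i, j). n < i + j}"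
    by (auto elim!: has_sum_cong[THEN iffD1, rotated])
  moreover have "((\<lambda>p. if p = (N, 0) then coef z 0 ^ N else 0) has_sum (coef z 0 ^ N)) {(i, j). n < i + j}"
    by (rule has_sum_finite_neutralI[of "{(N, 0)}"]) (use n in auto)
  ultimately show ?thesis by (rule has_sum_unique)
qed

text \<open>This is the real part of a geometric sum of \<open>q\<close>-th roots of unity.
  Coprimality makes its ratio 1 exactly when \<open>q\<close> divides \<open>n\<close>.\<close>

lemma sum_cos_multiples:
  fixes p :: int and q n :: nat
  assumes q: "0 < q" and cop: "coprime p (int q)"
  shows "(\<Sum>m<q. cos (real n * (th + (real m + 1) * (2 * pi * of_int p / real q))))
       = (if q dvd n then real q * cos (real n * th) else 0)"
proof -
  define x where "x = real n * (2 * pi * of_int p / real q)"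
  have "(\<Sum>m<q. cos (real n * (th + (real m + 1) * (2 * pi * of_int p / real q))))
      = Re (\<Sum>m<q. cis (real n * th + x) * cis x ^ m)"
    by (simp add: Complex.DeMoivre cis_mult x_def algebra_simps add_divide_distrib)
  also have "(\<Sum>m<q. cis (real n * th + x) * cis x ^ m) = cis (real n * th + x) * (\<Sum>m<q. cis x ^ m)"
    by (simp add: sum_distrib_left)
  finally have eq: "(\<Sum>m<q. cos (real n * (th + (real m + 1) * (2 * pi * of_int p / real q))))
      = Re (cis (real n * th + x) * (\<Sum>m<q. cis x ^ m))" .
  have x1: "cis x = 1 \<longleftrightarrow> q dvd n"
  proof -
    have "cis x = 1 \<longleftrightarrow> (\<exists>k::int. x = 2 * pi * of_int k)"
      unfolding cis_conv_exp exp_eq_1 by (simp add: ac_simps)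
    also have "\<dots> \<longleftrightarrow> (\<exists>k::int. int n * p = int q * k)"
    proof -
      have "x = 2 * pi * of_int k \<longleftrightarrow> int n * p = int q * k" for k
      proof -
        have "x = 2 * pi * of_int k \<longleftrightarrow> of_int (int n * p) = (of_int (int q * k) :: real)"
          using q by (simp add: x_def field_simps)
        then show ?thesis by (simp only: of_int_eq_iff)
      qed
      then show ?thesis by simp
    qed
    also have "\<dots> \<longleftrightarrow> int q dvd int n * p" by (auto simp: dvd_def)
    also have "\<dots> \<longleftrightarrow> q dvd n" using cop by (simp add: coprime_commute coprime_dvd_mult_left_iff)
    finally show ?thesis .
  qed
  show ?thesis
  proof (cases "q dvd n")
    case True
    then have "cis x = 1" using x1 by simp
    then have "cis (real n * th + x) * (\<Sum>m<q. cis x ^ m) = of_nat q * cis (real n * th)"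
      by (simp flip: cis_mult)
    then show ?thesis using True unfolding eq by simp
  next
    case False
    have "cis x ^ q = cis (2 * pi * of_int (int n * p))"
      using q by (simp add: Complex.DeMoivre x_def algebra_simps)
    also have "\<dots> = 1" by (intro cis_multiple_2pi) (simp only: Ints_of_int)
    finally have "(\<Sum>m<q. cis x ^ m) = 0"
      using False x1 by (simp add: geometric_sum)
    then show ?thesis using False unfolding eq by simp
  qed
qed

context rs_data
begin

lemma ell1_system: "rs_system s q r ell1_J ell1_X"
proof
  interpret algebra_hom "ell1_delta 0" by (rule algebra_hom_const)
  \<comment> \<open>Constants embed isometrically, so this norm equals the modulus 1 of the complex
    exponential and does not grow with \<open>t\<close>.\<close>
  have "exp (t *\<^sub>R ell1_J) = ell1_delta 0 (exp (t *\<^sub>R \<i>))" for t by (simp add: exp scaleR)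
  then show "norm (exp (t *\<^sub>R ell1_J)) \<le> 1" for t
    by (simp add: norm_ell1_delta norm_exp_i_times scaleR_conv_of_real mult.commute)
qed (simp_all add: norm_ell1_delta norm_ell1_X)

lemma complex_system: "(\<And>v. norm (a v) \<le> 1) \<Longrightarrow> rs_system s q r \<i> a"
  by standard (simp_all add: scaleR_conv_of_real mult.commute)

lemma rs_h_solution: "\<exists>d. rs_system.solution s q r w th ell1_J ell1_X (rs_h s q r w th) d"
proof -
  interpret rs_system s q r w th ell1_J ell1_X by (rule ell1_system)
  obtain h d where hd: "solution h d" using solution_ex1 by blast
  then have "rs_h s q r w th = h"
    unfolding rs_h_def using solution_unique by (intro the_equality) blast+
  then show ?thesis using hd by blast
qed

lemma ps_eval_hom:
  assumes "\<And>v. norm (a v) \<le> 1"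
  shows "rs_hom s q r ell1_J ell1_X \<i> a (\<lambda>f. ps_eval (coef f) a)"
  by (intro rs_hom.intro rs_hom_axioms.intro ell1_system complex_system algebra_hom_ps_eval)
     (use assms norm_ps_eval_le[OF assms] in \<open>auto simp: ps_eval_delta ps_eval_ell1_X\<close>)

text \<open>Evaluation sends the formal solution to a solution of the numerical system, which has
  only one.\<close>

lemma ps_eval_rs_h:
  assumes a: "\<And>v. norm (a v) \<le> 1" and sol: "rs_system.solution s q r w th \<i> a h d"
  shows "ps_eval (coef (rs_h s q r w th)) a = h"
proof -
  interpret H: rs_hom s q r w th ell1_J ell1_X \<i> a "\<lambda>f. ps_eval (coef f) a" by (rule ps_eval_hom[OF a])
  from rs_h_solution show ?thesis using H.solution H.B.solution_unique[OF _ sol] by blast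
qed

text \<open>First variation at \<open>a = 0\<close>. Each kick contributes the \<open>n\<close>-th
  powers of two conjugate points of the unperturbed orbit, that is
  \<open>2 r^n cos (n * angle)\<close>. Averaging over the orbit in \<open>shift\<close> leaves only
  the resonant \<open>n\<close>, and the linear term of \<open>exp h\<close> is that of
  \<open>h\<close>.\<close>

lemma coef_rs_h_single:
  assumes n: "2 * s < n" and w: "w = 2 * pi * of_int p / real q" and cop: "coprime p (int q)"
  shows "coef (rs_h s q r w th) (Poly_Mapping.single (n, 0) 1)
       = (if q dvd n then - of_real (2 * r ^ n / r ^ (2 * s) * cos (real n * th)) else 0)"
proof -
  let ?L = "\<lambda>f. coef f (Poly_Mapping.single (n, 0) 1)"
  interpret L: bounded_linear ?L by (rule bounded_linear_coef)
  interpret H: rs_hom s q r w th ell1_J ell1_X \<i> "\<lambda>_. 0" "\<lambda>f. ps_eval (coef f) (\<lambda>_. 0)"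
    by (rule ps_eval_hom) simp
  define h where "h = rs_h s q r w th"
  obtain d where sol: "H.A.solution h d" using rs_h_solution unfolding h_def by blast
  then have x: "norm h \<le> 1/4" "\<And>m. norm (d m) \<le> 1/4" by (auto simp: H.A.solution_def)
  \<comment> \<open>With all variables equal to 0 the kicks vanish and the zero solution is the only
    one, so \<open>h\<close> and all \<open>d m\<close> have constant term 0.\<close>
  have "dser (2 * s) (\<lambda>_. 0) z w = 0" for z w :: complex by (simp add: dser_def case_prod_unfold)
  then have "H.B.solution 0 (\<lambda>_. 0)"
    by (simp add: H.B.solution_def H.B.next_h_def H.B.next_d_def H.B.shift_def H.B.kick_def fun_eq_iff)
  from H.B.solution_unique[OF H.solution[OF sol] this]
  have zero: "coef h 0 = 0" "\<And>m. coef (d m) 0 = 0"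
    unfolding coef_0_eq_ps_eval by (auto dest: fun_cong)
  have point: "coef (rs_point s r ell1_J t h e) 0 = of_real r * cis t" if "coef e 0 = 0" for t e
    using H.point[of t h e] zero(1) that unfolding coef_0_eq_ps_eval
    by (simp add: rs_point_def scaleR_conv_of_real cis_conv_exp mult.commute)
  have tw: "coef (rs_twist s r h) 0 = 0"
    using H.twist[of h] zero(1) unfolding coef_0_eq_ps_eval by (simp add: rs_twist_def)
  have kick: "?L (H.A.kick h d m) = of_real (2 * r ^ n * cos (real n * H.A.angle m))" for m
  proof -
    have b: "norm (rs_point s r ell1_J t h e) \<le> 1/4" if "norm e \<le> 1/2" for t e
      using H.A.point_bound(1)[OF x(1) that] H.A.r_le by (rule order_trans)
    have e: "norm (d m + rs_twist s r h) \<le> 1/2" "norm (d (Suc m)) \<le> 1/2"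
      using norm_triangle_ineq[of "d m" "rs_twist s r h"] x(2)[of m] x(2)[of "Suc m"] H.A.twist_bound[OF x(1)]
      by auto
    have e': "norm (- (d m + rs_twist s r h)) \<le> 1/2" "norm (- d (Suc m)) \<le> 1/2"
      using e by (simp_all only: norm_minus_cancel)
    have c: "coef (d m + rs_twist s r h) 0 = 0" "coef (- d (Suc m)) 0 = 0"
      using zero tw by (auto simp: plus_ell1.rep_eq uminus_ell1.rep_eq)
    have "?L (H.A.kick h d m) = (of_real r * cis (H.A.angle m)) ^ n + (of_real r * cis (- H.A.angle m)) ^ n"
      unfolding H.A.kick_def plus_ell1.rep_eq
        coef_dser_single[OF b[OF e(1)] b[OF e'(1)] n] coef_dser_single[OF b[OF e'(2)] b[OF e(2)] n]
        point[OF c(1)] point[OF c(2)] ..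
    also have "\<dots> = of_real (2 * r ^ n * cos (real n * H.A.angle m))"
      by (simp add: power_mult_distrib Complex.DeMoivre complex_eq_iff)
    finally show ?thesis .
  qed
  have "?L (H.A.shift h d) = - of_real (2 * r ^ n / real q * (\<Sum>m<q. cos (real n * H.A.angle m)))"
    unfolding H.A.shift_def L.neg L.scaleR L.sum kick
    by (simp add: scaleR_conv_of_real sum_distrib_left)
  also have "(\<Sum>m<q. cos (real n * H.A.angle m)) = (if q dvd n then real q * cos (real n * th) else 0)"
    unfolding H.A.angle_def unfolding w by (rule sum_cos_multiples[OF q_pos cop])
  finally have sh: "?L (H.A.shift h d) = (if q dvd n then - of_real (2 * r ^ n * cos (real n * th)) else 0)"
    using q_pos by simp
  have "H.A.next_h h d = h" using sol by (simp add: H.A.solution_def)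
  then have "exp h = 1 + (1 / r ^ (2 * s)) *\<^sub>R H.A.shift h d"
    unfolding H.A.next_h_def by (simp add: algebra_simps)
  then have "?L (exp h) = ?L 1 + (1 / r ^ (2 * s)) *\<^sub>R ?L (H.A.shift h d)"
    by (simp only: L.add L.scaleR)
  moreover have "?L 1 = 0" using coef_mult_single[of 1 1 "(n, 0)"] by (simp add: one_ell1.rep_eq)
  ultimately have "?L h = (1 / r ^ (2 * s)) *\<^sub>R (if q dvd n then - of_real (2 * r ^ n * cos (real n * th)) else 0)"
    unfolding coef_exp_single[OF zero(1)] sh by simp
  then show ?thesis
    unfolding h_def[symmetric] by (simp add: scaleR_conv_of_real del: One_nat_def)
qed

end

section \<open>The map on invariant circles\<close>

lemma norm_cis_diff_le: "norm (cis x - cis y) \<le> \<bar>x - y\<bar>"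
proof -
  have "cis x - cis y = cis y * (cis (x - y) - 1)" by (simp add: cis_mult algebra_simps)
  then have "norm (cis x - cis y) = norm (cis (x - y) - 1)" by (simp add: norm_mult)
  also have "norm (cis u - 1) \<le> \<bar>u\<bar>" for u
  proof -
    have "(norm (cis u - 1))\<^sup>2 = (cos u - 1)\<^sup>2 + (sin u)\<^sup>2" by (simp add: cmod_power2)
    also have "\<dots> = 2 - 2 * cos u"
      using sin_cos_squared_add[of u] by (simp add: power2_eq_square algebra_simps)
    also have "\<dots> = (2 * sin (u / 2))\<^sup>2"
      using cos_double_sin[of "u/2"] by (simp add: power2_eq_square)
    finally have "norm (cis u - 1) = \<bar>2 * sin (u / 2)\<bar>"
      by (metis abs_norm_cancel power2_eq_iff_nonneg abs_ge_zero power2_abs)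
    also have "\<dots> \<le> \<bar>u\<bar>" using abs_sin_x_le_abs_x[of "u/2"] by simp
    finally show ?thesis .
  qed
  finally show ?thesis .
qed

locale sigma_point =
  fixes s :: nat and a :: "nat \<times> nat \<Rightarrow> complex"
  assumes s_pos: "0 < s" and a_Sigma: "a \<in> Sigma_set s"
begin

text \<open>Values outside \<open>idx s\<close> are unrestricted, and are cut off before evaluating power series.\<close>

definition trunc :: "nat \<times> nat \<Rightarrow> complex" where
  "trunc v = (if v \<in> idx s then a v else 0)"

lemma
  assumes "2 * s < i + j"
  shows norm_a_less: "norm (a (i, j)) < 1" and cnj_a: "cnj (a (i, j)) = a (j, i)"
  using a_Sigma assms unfolding Sigma_set_def mem_Collect_eq by metis+

lemma norm_trunc_le: "norm (trunc v) \<le> 1"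
  by (cases v) (auto simp: trunc_def idx_def intro!: less_imp_le norm_a_less)

lemma atilde_eq_dser: "atilde s a z = dser (2 * s) trunc z (cnj z)"
  unfolding atilde_def dser_def idx_def
  by (rule infsum_cong) (auto simp: trunc_def idx_def)

text \<open>The symmetry of the coefficients makes the series real, so that \<open>phi\<close>
  rotates every circle about 0 into itself.\<close>

lemma cnj_atilde: "cnj (atilde s a z) = atilde s a z"
proof -
  have "cnj (atilde s a z) = (\<Sum>\<^sub>\<infinity>(i, j)\<in>idx s. a (j, i) * cnj z ^ i * z ^ j)"
    unfolding atilde_def infsum_cnj[symmetric]
    by (intro infsum_cong) (auto simp: cnj_a idx_def)
  also have "\<dots> = atilde s a z"
    unfolding atilde_def
    by (rule infsum_reindex_bij_witness[of _ prod.swap prod.swap]) (auto simp: idx_def ac_simps)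
  finally show ?thesis .
qed

definition g :: "complex \<Rightarrow> real" where "g z = Re (atilde s a z)"

lemma atilde_eq_g: "atilde s a z = of_real (g z)"
  using cnj_atilde[of z] by (simp add: g_def complex_eq_iff)

definition K :: real where "K = 4 ^ (2 * s + 2)"

lemma g_lipschitz:
  assumes "norm z \<le> R" "norm z' \<le> R" "R \<le> 1/4"
  shows "\<bar>g z - g z'\<bar> \<le> K * R ^ (2 * s) * norm (z - z')"
proof -
  have "\<bar>g z - g z'\<bar> = norm (atilde s a z - atilde s a z')"
    unfolding atilde_eq_g by (metis norm_of_real of_real_diff)
  also have "\<dots> \<le> K * R ^ (2 * s) * norm (z - z')"
    unfolding atilde_eq_dser K_def
    by (rule dser_lipschitz) (use assms norm_trunc_le in \<open>auto simp flip: complex_cnj_diff\<close>)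
  finally show ?thesis .
qed

lemma g_bound:
  assumes "norm z \<le> R" "R \<le> 1/4"
  shows "\<bar>g z\<bar> \<le> K * R ^ (2 * s + 1)"
proof -
  have "\<bar>g z\<bar> = norm (atilde s a z)" unfolding atilde_eq_g by simp
  also have "\<dots> \<le> K * R ^ (2 * s + 1)"
    unfolding atilde_eq_dser K_def by (rule dser_norm_le) (use assms norm_trunc_le in auto)
  finally show ?thesis .
qed

lemma phi_eq: "phi s a z = z * cis (g z)"
  by (simp add: phi_def atilde_eq_g cis_conv_exp)

lemma norm_phi [simp]: "norm (phi s a z) = norm z"
  by (simp add: phi_eq norm_mult)

text \<open>Chosen such that on this disc the rotation by \<open>g\<close> moves points with
  Lipschitz constant at most 1/4, which gives both injectivity and surjectivity of
  \<open>phi\<close> on circles.\<close>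

definition R0 :: real where "R0 = 1 / (4 * K)"

lemma K_ge: "4 \<le> K"
proof -
  have "(4::real) ^ 1 \<le> 4 ^ (2 * s + 2)" by (rule power_increasing) auto
  then show ?thesis by (simp add: K_def)
qed

lemma R0: "0 < R0" "R0 \<le> 1/4" "K * R0 = 1/4"
  using K_ge by (auto simp: R0_def field_simps)

lemma g_lipschitz_sphere:
  assumes "norm z \<le> R0" "norm z' \<le> R0"
  shows "R0 * \<bar>g z - g z'\<bar> \<le> 1/4 * norm (z - z')"
proof -
  have "R0 * \<bar>g z - g z'\<bar> \<le> R0 * (K * R0 ^ (2 * s) * norm (z - z'))"
    using R0 assms by (intro mult_left_mono g_lipschitz) auto
  also have "\<dots> = (K * R0) * R0 ^ (2 * s) * norm (z - z')" by simp
  also have "\<dots> \<le> 1/4 * 1 * norm (z - z')"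
    unfolding R0(3) using R0 by (intro mult_right_mono mult_left_mono power_le_one) auto
  finally show ?thesis by simp
qed

lemma inj_on_phi: "inj_on (phi s a) (ball 0 R0)"
proof (rule inj_onI)
  fix z z' assume z: "z \<in> ball 0 R0" "z' \<in> ball 0 R0" and eq: "phi s a z = phi s a z'"
  have "z = z * cis (g z) * cis (- g z)" by (simp add: cis_mult mult.assoc)
  also have "\<dots> = z' * cis (g z' - g z)" using eq by (simp add: phi_eq cis_mult mult.assoc)
  finally have "norm (z - z') = norm (z' * (cis (g z' - g z) - cis 0))" by (simp add: algebra_simps)
  also have "\<dots> \<le> R0 * \<bar>g z' - g z - 0\<bar>"
    unfolding norm_mult using z R0 by (intro mult_mono norm_cis_diff_le) auto
  also have "\<dots> \<le> 1/4 * norm (z' - z)" using g_lipschitz_sphere[of z' z] z by simp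
  finally show "z = z'" by (simp add: norm_minus_commute)
qed

text \<open>A preimage has the same modulus as \<open>w\<close>, so it is found on that circle as
  the fixed point of the contraction \<open>y \<mapsto> w * cis (- g y)\<close>.\<close>

lemma phi_preimage:
  assumes "norm w < R0" shows "\<exists>y. norm y = norm w \<and> phi s a y = w"
proof -
  have "\<exists>!y\<in>sphere 0 (norm w). w * cis (- g y) = y"
  proof (rule Banach_fix[where c = "1/4"])
    show "complete (sphere (0::complex) (norm w))" by (intro compact_imp_complete compact_sphere)
    show "sphere (0::complex) (norm w) \<noteq> {}" by (auto intro!: exI[of _ w])
    show "(\<lambda>y. w * cis (- g y)) ` sphere 0 (norm w) \<subseteq> sphere 0 (norm w)" by (auto simp: norm_mult)
    fix x y :: complex assume "x \<in> sphere 0 (norm w)" "y \<in> sphere 0 (norm w)"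
    then have xy: "norm x \<le> R0" "norm y \<le> R0" using assms by auto
    have "dist (w * cis (- g x)) (w * cis (- g y)) = norm w * norm (cis (- g x) - cis (- g y))"
      by (simp add: dist_norm norm_mult flip: right_diff_distrib)
    also have "\<dots> \<le> R0 * \<bar>- g x - (- g y)\<bar>"
      using assms R0 by (intro mult_mono norm_cis_diff_le) auto
    also have "\<dots> \<le> 1/4 * dist x y" using g_lipschitz_sphere[OF xy] by (simp add: dist_norm abs_minus_commute)
    finally show "dist (w * cis (- g x)) (w * cis (- g y)) \<le> 1/4 * dist x y" .
  qed auto
  then obtain y where y: "norm y = norm w" "w * cis (- g y) = y" by auto
  have "phi s a y = w * cis (- g y) * cis (g y)" using y(2) by (simp add: phi_eq)
  then have "phi s a y = w" by (simp add: cis_mult mult.assoc)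
  with y show ?thesis by blast
qed

text \<open>\<open>phi_inv\<close> refers to an unspecified radius of injectivity. Below both that
  radius and \<open>R0\<close> it is a genuine two-sided inverse.\<close>

definition inj_radius :: real where
  "inj_radius = min R0 (SOME r. r > 0 \<and> inj_on (phi s a) (ball 0 r))"

lemma
  shows inj_radius: "0 < inj_radius" "inj_radius \<le> R0"
    and phi_inv: "\<And>w. norm w < inj_radius \<Longrightarrow> norm (phi_inv s a w) = norm w \<and> phi s a (phi_inv s a w) = w"
    and phi_inv_unique: "\<And>y. norm y < inj_radius \<Longrightarrow> phi_inv s a (phi s a y) = y"
proof -
  let ?r = "SOME r. r > 0 \<and> inj_on (phi s a) (ball 0 r)"
  have r: "?r > 0 \<and> inj_on (phi s a) (ball 0 ?r)"
    by (rule someI[of _ R0]) (use inj_on_phi R0 in auto)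
  show "0 < inj_radius" "inj_radius \<le> R0" using r R0 by (auto simp: inj_radius_def)
  show u: "phi_inv s a (phi s a y) = y" if "norm y < inj_radius" for y
    unfolding phi_inv_def by (rule inv_into_f_f) (use r that in \<open>auto simp: inj_radius_def\<close>)
  show "norm (phi_inv s a w) = norm w \<and> phi s a (phi_inv s a w) = w" if w: "norm w < inj_radius" for w
  proof -
    obtain y where y: "norm y = norm w" "phi s a y = w"
      using phi_preimage[of w] w by (auto simp: inj_radius_def)
    then show ?thesis using u[of y] w by simp
  qed
qed

definition T_angle :: "real \<Rightarrow> complex \<Rightarrow> real" where "T_angle \<alpha> z = \<alpha> + norm z ^ (2 * s)"

lemma Tmap_eq: "Tmap s \<alpha> z = z * cis (T_angle \<alpha> z)"
proof -
  have "(z * cnj z) ^ s = of_real (norm z ^ (2 * s))"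
    by (simp add: complex_norm_square[symmetric] power_mult)
  then show ?thesis by (simp add: Tmap_def cis_conv_exp T_angle_def)
qed

text \<open>
  Instead of \<open>z\<close> we follow \<open>y\<close> with \<open>z = base y\<close>, that is \<open>y = \<tau> \<phi>\<^sub>a\<^sup>-\<^sup>1 \<tau> z\<close>; this replaces the inverse of \<open>\<phi>\<^sub>a\<close>
  by the implicit recursion \<open>next_y_eq\<close>, which involves only \<open>\<phi>\<^sub>a\<close>.
\<close>

definition base :: "complex \<Rightarrow> complex" where "base y = cnj (phi s a (cnj y))"

definition next_y :: "real \<Rightarrow> complex \<Rightarrow> complex" where
  "next_y \<alpha> y = cnj (phi_inv s a (cnj (phi s a (Tmap s \<alpha> y))))"

lemma base_eq: "base y = y * cis (- g (cnj y))"
  by (simp add: base_def phi_eq cis_cnj)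

lemma norm_base [simp]: "norm (base y) = norm y"
  by (simp add: base_eq norm_mult)

lemma norm_Tmap [simp]: "norm (Tmap s \<alpha> z) = norm z"
  by (simp add: Tmap_eq norm_mult)

section \<open>Orbits in the coordinate given by \<open>base\<close>\<close>

context
  fixes \<alpha> :: real
begin

lemma norm_varphi: "norm z < inj_radius \<Longrightarrow> norm (varphi s \<alpha> a z) = norm z"
  using phi_inv[of "cnj z"] by (simp add: varphi_def)

lemma norm_next_y: "norm y < inj_radius \<Longrightarrow> norm (next_y \<alpha> y) = norm y"
  using phi_inv[of "cnj (phi s a (Tmap s \<alpha> y))"] by (simp add: next_y_def)

lemma base_next_y: "norm y < inj_radius \<Longrightarrow> base (next_y \<alpha> y) = phi s a (Tmap s \<alpha> y)"
  using phi_inv[of "cnj (phi s a (Tmap s \<alpha> y))"] by (simp add: next_y_def base_def)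

lemma varphi_base: "norm y < inj_radius \<Longrightarrow> varphi s \<alpha> a (base y) = base (next_y \<alpha> y)"
  using phi_inv_unique[of "cnj y"] by (simp add: varphi_def base_def[of y] base_next_y)

lemma norm_next_y_funpow: "norm y < inj_radius \<Longrightarrow> norm ((next_y \<alpha> ^^ n) y) = norm y"
  by (induction n) (auto simp: norm_next_y)

lemma varphi_funpow_base:
  "norm y < inj_radius \<Longrightarrow> (varphi s \<alpha> a ^^ n) (base y) = base ((next_y \<alpha> ^^ n) y)"
  by (induction n) (auto simp: varphi_base norm_next_y_funpow)

lemma inj_on_base: "inj_on base (ball 0 inj_radius)"
proof (rule inj_onI)
  fix y y' assume "y \<in> ball 0 inj_radius" "y' \<in> ball 0 inj_radius" "base y = base y'"
  then show "y = y'" using inj_onD[OF inj_on_phi, of "cnj y" "cnj y'"] inj_radius by (auto simp: base_def)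
qed

lemma next_y_eq:
  assumes "norm y < inj_radius"
  shows "next_y \<alpha> y = y * cis (T_angle \<alpha> y + g (y * cis (T_angle \<alpha> y)) + g (cnj (next_y \<alpha> y)))"
proof -
  let ?n = "next_y \<alpha> y"
  have "?n = base ?n * cis (g (cnj ?n))"
    by (simp add: base_eq cis_mult mult.assoc)
  also have "\<dots> = y * cis (T_angle \<alpha> y) * cis (g (y * cis (T_angle \<alpha> y))) * cis (g (cnj ?n))"
    unfolding base_next_y[OF assms] phi_eq Tmap_eq ..
  finally show ?thesis by (simp add: cis_mult mult.assoc add.assoc)
qed

text \<open>The orbit stays on the circle of radius \<open>\<rho>\<close>, and its polar angles
  satisfy the recursion of \<open>rs_system\<close> with kicks \<open>k\<close> and twist
  \<open>\<delta>\<close>. \<open>C\<close> compares \<open>\<rho>\<close> with \<open>r\<close>;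
  the smallness conditions on it fix the winding number and put the orbit into the ball where
  solutions are unique.\<close>

lemma periodic_imp_solution:
  fixes p :: int
  assumes rs: "rs_data s q r" and w: "w = 2 * pi * of_int p / real q" and r: "r ^ (2 * s) = w - \<alpha>"
    and \<rho>: "0 < \<rho>" "\<rho> < inj_radius"
    and per: "(varphi s \<alpha> a ^^ q) (base (\<rho> * cis th)) = base (\<rho> * cis th)"
    and C: "\<rho> ^ (2 * s) \<le> C * r ^ (2 * s)" "K * \<rho> ^ (2 * s + 1) \<le> C * r ^ (2 * s + 1)"
    and Cr: "C * r \<le> 1/16" and Cq: "C * (real q * r ^ (2 * s)) \<le> 1"
  shows "\<exists>d. rs_system.solution s q r w th \<i> trunc (of_real (2 * real s * ln (\<rho> / r))) d"
proof -
  interpret rs_data s q r by (rule rs)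
  interpret rs_system s q r w th \<i> trunc by (rule complex_system[OF norm_trunc_le])
  define \<omega> where "\<omega> = \<alpha> + \<rho> ^ (2 * s)"
  define y where "y = (\<lambda>m. (next_y \<alpha> ^^ m) (\<rho> * cis th))"
  define k where "k = (\<lambda>m. g (y m * cis \<omega>) + g (cnj (y (Suc m))))"
  define \<delta> where "\<delta> = \<rho> ^ (2 * s) - r ^ (2 * s)"
  have n0: "norm (\<rho> * cis th) = \<rho>" using \<rho> by (simp add: norm_mult)
  have ny: "norm (y m) = \<rho>" for m
    using norm_next_y_funpow[of "\<rho> * cis th" m] \<rho> unfolding y_def n0 by simp
  have yS: "y (Suc m) = y m * cis (\<omega> + k m)" for m
    using next_y_eq[of "y m"] \<rho> by (simp add: ny y_def[THEN fun_cong, of "Suc _"] T_angle_def \<omega>_def k_def add.assoc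
        flip: y_def) (simp add: y_def)
  have ypol: "y m = \<rho> * cis (th + (\<Sum>l<m. \<omega> + k l))" for m
    by (induction m) (simp add: y_def, simp add: yS cis_mult mult.assoc add.assoc)
  have \<rho>4: "\<rho> \<le> 1/4" using \<rho> inj_radius R0 by simp
  have kb: "\<bar>k m\<bar> \<le> 2 * (C * r ^ (2 * s + 1))" for m
    using g_bound[of "y m * cis \<omega>" \<rho>] g_bound[of "cnj (y (Suc m))" \<rho>] C(2) \<rho>4
    by (simp add: norm_mult ny k_def)
  have r16: "C * r ^ (2 * s + 1) \<le> 1/16 * r ^ (2 * s)"
    using mult_right_mono[OF Cr, of "r ^ (2 * s)"] r_pos by (simp add: ac_simps)
  have kb': "\<bar>k m\<bar> \<le> 1/8 * r ^ (2 * s)" for m using kb[of m] r16 by simp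
  have sum_k: "\<bar>\<Sum>l<m. k l\<bar> \<le> real m * (1/8 * r ^ (2 * s))" for m
    using order_trans[OF sum_abs sum_mono[of "{..<m}" "\<lambda>l. \<bar>k l\<bar>", OF kb']] by simp
  have yq: "y q = \<rho> * cis th"
  proof (rule inj_onD[OF inj_on_base])
    show "base (y q) = base (\<rho> * cis th)"
      using per varphi_funpow_base[of "\<rho> * cis th" q] \<rho> n0 by (simp add: y_def)
  qed (use \<rho> n0 ny in auto)
  then have "cis (\<Sum>l<q. \<omega> + k l) = 1"
    using ypol[of q] \<rho> by (simp add: cis_mult[symmetric])
  then obtain n :: int where n: "(\<Sum>l<q. \<omega> + k l) = 2 * pi * of_int n"
    unfolding cis_conv_exp exp_eq_1 by (auto simp: ac_simps)
  have qw: "real q * w = 2 * pi * of_int p" using q_pos by (simp add: w)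
  have eq: "2 * pi * of_int (n - p) = real q * \<delta> + (\<Sum>l<q. k l)"
  proof -
    have "real q * \<alpha> + real q * \<rho> ^ (2 * s) + (\<Sum>l<q. k l) = 2 * pi * of_int n"
      using n by (simp add: \<omega>_def sum.distrib distrib_left)
    moreover have "real q * \<alpha> = 2 * pi * of_int p - real q * r ^ (2 * s)"
      using r qw by (metis diff_diff_eq2 add_diff_cancel_left' right_diff_distrib)
    moreover have "2 * pi * of_int (n - p) = 2 * pi * of_int n - 2 * pi * of_int p"
      by (simp add: right_diff_distrib)
    moreover have "real q * \<delta> = real q * \<rho> ^ (2 * s) - real q * r ^ (2 * s)"
      by (simp add: \<delta>_def right_diff_distrib)
    ultimately show ?thesis by linarith
  qed
  \<comment> \<open>The orbit closes after some number \<open>n\<close> of turns. The difference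
    from \<open>p\<close> turns is less than one full turn, hence \<open>n = p\<close>.\<close>
  have "\<bar>real q * \<delta> + (\<Sum>l<q. k l)\<bar> < 2 * pi"
  proof -
    have "real q * \<rho> ^ (2 * s) \<le> C * (real q * r ^ (2 * s))"
      using mult_left_mono[OF C(1), of "real q"] by (simp add: ac_simps)
    then have "\<bar>real q * \<delta>\<bar> \<le> 2"
      using q_r Cq \<rho> r_pos by (auto simp: \<delta>_def right_diff_distrib abs_le_iff)
         (smt (verit) mult_nonneg_nonneg of_nat_0_le_iff zero_le_power)+
    moreover have "\<bar>\<Sum>l<q. k l\<bar> \<le> 1/8" using sum_k[of q] q_r by simp
    ultimately show ?thesis using pi_gt3 by linarith
  qed
  then have "\<bar>real_of_int (n - p)\<bar> < 1"
    unfolding eq[symmetric] by (simp add: abs_mult)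
  then have "n = p" by linarith
  with eq have q\<delta>: "real q * \<delta> + (\<Sum>l<q. k l) = 0" by simp
  \<comment> \<open>Since the orbit closes exactly, \<open>\<delta>\<close> is minus the mean of the
    kicks and inherits their bound; a priori only \<open>C * r ^ (2 * s)\<close> controlled
    \<open>\<rho> ^ (2 * s)\<close>.\<close>
  have \<delta>b: "\<bar>\<delta>\<bar> \<le> 1/8 * r ^ (2 * s)"
  proof -
    have "real q * \<bar>\<delta>\<bar> = \<bar>real q * \<delta>\<bar>" by (simp add: abs_mult)
    also have "\<dots> = \<bar>\<Sum>l<q. k l\<bar>" using q\<delta> by linarith
    also have "\<dots> \<le> real q * (1/8 * r ^ (2 * s))" by (rule sum_k)
    finally have "real q * \<bar>\<delta>\<bar> \<le> real q * (1/8 * r ^ (2 * s))" .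
    then show ?thesis using q_pos by simp
  qed
  \<comment> \<open>The deviation from uniform rotation by \<open>w\<close>, because
    \<open>\<omega> = w + \<delta>\<close>; the value 0 beyond \<open>q\<close> agrees with
    \<open>next_d\<close>.\<close>
  define D where "D = (\<lambda>m. if m \<le> q then real m * \<delta> + (\<Sum>l<m. k l) else 0)"
  define h where "h = 2 * real s * ln (\<rho> / r)"
  have Db: "\<bar>D m\<bar> \<le> 1/4" for m
  proof (cases "m \<le> q")
    case True
    have "\<bar>D m\<bar> \<le> real m * \<bar>\<delta>\<bar> + \<bar>\<Sum>l<m. k l\<bar>"
      using True abs_triangle_ineq[of "real m * \<delta>"] by (simp add: D_def abs_mult)
    also have "\<dots> \<le> real m * (1/8 * r ^ (2 * s)) + real m * (1/8 * r ^ (2 * s))"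
      by (intro add_mono mult_left_mono \<delta>b sum_k) auto
    also have "\<dots> \<le> real q * (1/4 * r ^ (2 * s))" using True r_pos by simp
    finally show ?thesis using q_r by simp
  qed (simp add: D_def)
  have exph: "exp h = \<rho> ^ (2 * s) / r ^ (2 * s)"
  proof -
    have "exp h = exp (ln (\<rho> / r)) ^ (2 * s)" unfolding h_def by (subst exp_of_nat_mult[symmetric]) simp
    then show ?thesis using \<rho> r_pos by (simp add: power_divide)
  qed
  have exph2: "exp (h / (2 * real s)) = \<rho> / r"
    using \<rho> r_pos s_pos by (simp add: h_def)
  have tw: "rs_twist s r (complex_of_real h) = of_real \<delta>"
  proof -
    have "rs_twist s r (complex_of_real h) = of_real (r ^ (2 * s) * (exp h - 1))"
      by (simp add: rs_twist_def scaleR_conv_of_real exp_of_real)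
    also have "r ^ (2 * s) * (exp h - 1) = \<delta>" unfolding exph using r_pos by (simp add: \<delta>_def field_simps)
    finally show ?thesis .
  qed
  have hb: "\<bar>h\<bar> \<le> 1/4"
  proof -
    define x where "x = \<delta> / r ^ (2 * s)"
    have x: "\<bar>x\<bar> \<le> 1/8" using \<delta>b r_pos by (simp add: x_def field_simps)
    have "exp h = 1 + x" unfolding exph x_def using r_pos by (simp add: \<delta>_def field_simps)
    then have "h = ln (1 + x)" by (metis ln_exp)
    moreover have "\<bar>ln (1 + x) - x\<bar> \<le> 2 * x\<^sup>2" using x by (intro abs_ln_one_plus_x_minus_x_bound) simp
    moreover have "x\<^sup>2 \<le> (1/8)\<^sup>2" using x by (metis abs_le_square_iff abs_of_nonneg zero_le_divide_1_iff zero_le_numeral)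
    ultimately show ?thesis using x by (simp add: power2_eq_square)
  qed
  have point: "rs_point s r \<i> t (complex_of_real h) (of_real e) = \<rho> * cis (t + e)" for t e
  proof -
    have hh: "(1 / (2 * real s)) *\<^sub>R complex_of_real h = of_real (h / (2 * real s))"
      by (simp add: scaleR_conv_of_real)
    have "rs_point s r \<i> t (complex_of_real h) (of_real e)
        = of_real (r * exp (h / (2 * real s))) * (cis t * cis e)"
      unfolding rs_point_def hh exp_add exp_of_real
      by (simp add: scaleR_conv_of_real cis_conv_exp mult_ac del: of_real_divide)
    then show ?thesis unfolding exph2 using r_pos by (simp add: cis_mult)
  qed
  have pt: "th + (\<Sum>l<m. \<omega> + k l) = th + real m * w + D m" if "m \<le> q" for m
  proof -
    have "\<omega> = w + \<delta>" using r by (simp add: \<omega>_def \<delta>_def)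
    then show ?thesis using that by (simp add: D_def sum.distrib algebra_simps)
  qed
  have kick: "kick (of_real h) (\<lambda>m. of_real (D m)) m = of_real (k m)" if "m < q" for m
  proof -
    have y0: "y m * cis \<omega> = \<rho> * cis (angle m + (D m + \<delta>))"
    proof -
      have "th + (\<Sum>l<m. \<omega> + k l) + \<omega> = angle m + (D m + \<delta>)"
        using pt[of m] that r by (simp add: angle_def \<omega>_def \<delta>_def distrib_right)
      then show ?thesis unfolding ypol by (simp only: mult.assoc cis_mult)
    qed
    have y1: "y (Suc m) = \<rho> * cis (angle m + D (Suc m))"
    proof -
      have "th + (\<Sum>l<Suc m. \<omega> + k l) = angle m + D (Suc m)"
        using pt[of "Suc m"] that by (simp only: angle_def of_nat_Suc) simp
      then show ?thesis unfolding ypol by (simp only:)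
    qed
    have c: "cnj (\<rho> * cis x) = \<rho> * cis (- x)" for x by (simp add: cis_cnj)
    have p: "rs_point s r \<i> (angle m) (complex_of_real h) (of_real (D m) + of_real \<delta>) = y m * cis \<omega>"
      "rs_point s r \<i> (- angle m) (complex_of_real h) (- (of_real (D m) + of_real \<delta>)) = cnj (y m * cis \<omega>)"
      "rs_point s r \<i> (- angle m) (complex_of_real h) (- of_real (D (Suc m))) = cnj (y (Suc m))"
      "rs_point s r \<i> (angle m) (complex_of_real h) (of_real (D (Suc m))) = y (Suc m)"
      unfolding y0 y1 c
      using point[of "angle m" "D m + \<delta>"] point[of "- angle m" "- (D m + \<delta>)"]
        point[of "- angle m" "- D (Suc m)"] point[of "angle m" "D (Suc m)"]
      by simp_all
    show ?thesis
      unfolding kick_def tw p k_def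
      using atilde_eq_dser[of "y m * cis \<omega>"] atilde_eq_dser[of "cnj (y (Suc m))"]
      by (simp add: atilde_eq_g)
  qed
  have shift: "shift (of_real h) (\<lambda>m. of_real (D m)) = of_real \<delta>"
  proof -
    have "shift (of_real h) (\<lambda>m. of_real (D m)) = of_real (- ((\<Sum>l<q. k l) / real q))"
      by (simp add: shift_def kick scaleR_conv_of_real divide_inverse mult.commute)
    also have "- ((\<Sum>l<q. k l) / real q) = \<delta>" using q\<delta> q_pos by (simp add: field_simps)
    finally show ?thesis .
  qed
  have "solution (of_real h) (\<lambda>m. of_real (D m))"
    unfolding solution_def
  proof (intro conjI allI ext)
    show "norm (complex_of_real h) \<le> 1/4" using hb by simp
    show "norm (complex_of_real (D m)) \<le> 1/4" for m using Db by simp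
    have "rs_twist s r (complex_of_real h) = r ^ (2 * s) *\<^sub>R (exp (complex_of_real h) - 1)"
      by (simp add: rs_twist_def)
    then show "next_h (of_real h) (\<lambda>m. of_real (D m)) = of_real h"
      using r_pos unfolding next_h_def shift tw by simp
    show "next_d (of_real h) (\<lambda>m. of_real (D m)) m = of_real (D m)" for m
    proof (cases "m \<le> q")
      case True
      then have "(\<Sum>l<m. kick (of_real h) (\<lambda>m. of_real (D m)) l) = of_real (\<Sum>l<m. k l)"
        by (simp add: kick)
      moreover have "D m = real m * \<delta> + (\<Sum>l<m. k l)" using True by (simp add: D_def)
      ultimately show ?thesis using True
        unfolding next_d_def shift by (simp add: scaleR_conv_of_real)
    qed (simp add: next_d_def D_def)
  qed
  then show ?thesis unfolding h_def by blast
qed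

end

end

section \<open>Convergent conjugacies\<close>

text \<open>Absolute convergence at one point \<open>t > 0\<close> bounds the scaled coefficients
  \<open>c i j * t ^ (i + j)\<close> by \<open>M\<close>. The part of degree at least 2 is then a
  multiple of a \<open>dser\<close> with coefficients of norm at most 1 in the rescaled variables,
  ready for \<open>dser_lipschitz\<close>.\<close>

lemma real_analytic_at0_expansion:
  assumes "real_analytic_at0 \<Phi>"
  obtains t M X c0 c1 c2 where "0 < t" "0 < M" "\<And>v. norm (X v) \<le> 1"
    "\<And>z. norm z \<le> t / 4 \<Longrightarrow> \<Phi> z = c0 + (c1 * z + c2 * cnj z) + of_real M * dser 1 X (z / of_real t) (cnj z / of_real t)"
proof -
  obtain c r where r: "r > 0" and sum: "\<And>z. z \<in> ball 0 r \<Longrightarrow> (\<lambda>(i, j). norm (c i j * z ^ i * cnj z ^ j)) summable_on UNIV"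
    and \<Phi>: "\<And>z. z \<in> ball 0 r \<Longrightarrow> \<Phi> z = (\<Sum>\<^sub>\<infinity>(i, j). c i j * z ^ i * cnj z ^ j)"
    using assms unfolding real_analytic_at0_def by blast
  define t where "t = r / 2"
  have t: "0 < t" "complex_of_real t \<in> ball 0 r" using r by (auto simp: t_def)
  define f where "f = (\<lambda>(i, j). norm (c i j * of_real t ^ i * cnj (of_real t) ^ j))"
  have fs: "f summable_on UNIV" using sum[OF t(2)] by (simp add: f_def)
  define M where "M = infsum f UNIV + 1"
  have f0: "f p \<ge> 0" for p by (cases p) (simp add: f_def)
  have fM: "f p \<le> M" for p
    using finite_sum_le_infsum[OF fs, of "{p}"] f0 by (simp add: M_def)
  have M: "0 < M" using infsum_nonneg[of UNIV f] f0 by (simp add: M_def add_nonneg_pos)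
  define X where "X = (\<lambda>(i, j). c i j * of_real t ^ (i + j) / of_real M)"
  have X: "norm (X v) \<le> 1" for v
    using fM[of v] t M by (cases v) (simp add: X_def f_def norm_mult norm_divide norm_power power_add mult.assoc)
  have "\<Phi> z = c 0 0 + (c 1 0 * z + c 0 1 * cnj z) + of_real M * dser 1 X (z / of_real t) (cnj z / of_real t)"
    if z: "norm z \<le> t / 4" for z
  proof -
    let ?F = "\<lambda>(i, j). c i j * z ^ i * cnj z ^ j"
    let ?A = "{(i, j). i + j \<le> (1::nat)}" and ?B = "{(i, j). (1::nat) < i + j}"
    have zr: "z \<in> ball 0 r" using z t r by (simp add: t_def)
    have "?F summable_on UNIV"
      by (rule abs_summable_summable) (use sum[OF zr] in \<open>simp add: case_prod_unfold\<close>)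
    then have s: "?F summable_on A" for A by (rule summable_on_subset_banach) auto
    have A: "?A = {(0, 0), (1, 0), (0, 1)}" by auto
    have "\<Phi> z = infsum ?F (?A \<union> ?B)" unfolding \<Phi>[OF zr] by (rule arg_cong[where f = "infsum _"]) auto
    also have "\<dots> = infsum ?F ?A + infsum ?F ?B" by (rule infsum_Un_disjoint[OF s s]) auto
    also have "infsum ?F ?A = c 0 0 + (c 1 0 * z + c 0 1 * cnj z)" unfolding A by simp
    also have "infsum ?F ?B = of_real M * dser 1 X (z / of_real t) (cnj z / of_real t)"
      unfolding dser_def infsum_cmult_right'[symmetric] using M t
      by (intro infsum_cong) (auto simp: X_def power_divide power_add)
    finally show ?thesis .
  qed
  with t(1) M X that show ?thesis by blast
qed

text \<open>On a small ball the terms of degree at least 2 have a small Lipschitz constant, so the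
  linear part, which is bounded below, dominates differences.\<close>

lemma conv_transf_bilipschitz:
  assumes "conv_transf \<Phi>"
  obtains c \<delta> where "0 < c" "0 < \<delta>" "continuous_on (ball 0 \<delta>) \<Phi>"
    "\<And>z z'. z \<in> ball 0 \<delta> \<Longrightarrow> z' \<in> ball 0 \<delta> \<Longrightarrow> c * norm (z - z') \<le> norm (\<Phi> z - \<Phi> z')"
proof -
  have an: "real_analytic_at0 \<Phi>" and \<Phi>0: "\<Phi> 0 = 0" using assms by (auto simp: conv_transf_def)
  obtain L where L: "(\<Phi> has_derivative L) (at 0)" "bij L" using assms by (auto simp: conv_transf_def)
  obtain t M X c0 c1 c2 where t: "0 < t" "0 < M" and X: "\<And>v. norm (X v) \<le> 1"
    and \<Phi>: "\<And>z. norm z \<le> t / 4 \<Longrightarrow> \<Phi> z = c0 + (c1 * z + c2 * cnj z) + of_real M * dser 1 X (z / of_real t) (cnj z / of_real t)"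
    by (rule real_analytic_at0_expansion[OF an]) blast
  define \<Lambda> where "\<Lambda> = (\<lambda>z. c1 * z + c2 * cnj z)"
  define C where "C = 64 * M / t\<^sup>2"
  have C: "0 < C" using t by (simp add: C_def)
  have diff: "norm ((\<Phi> z - \<Phi> z') - \<Lambda> (z - z')) \<le> C * R * norm (z - z')"
    if "norm z \<le> R" "norm z' \<le> R" "R \<le> t / 4" for z z' R
  proof -
    have "(\<Phi> z - \<Phi> z') - \<Lambda> (z - z')
        = of_real M * (dser 1 X (z / of_real t) (cnj z / of_real t) - dser 1 X (z' / of_real t) (cnj z' / of_real t))"
      using \<Phi>[of z] \<Phi>[of z'] that by (simp add: \<Lambda>_def algebra_simps)
    also have "norm \<dots> = M * norm (dser 1 X (z / of_real t) (cnj z / of_real t) - dser 1 X (z' / of_real t) (cnj z' / of_real t))"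
      using t by (simp add: norm_mult)
    also have "\<dots> \<le> M * (4 ^ (1 + 2) * (R / t) ^ 1 * (norm (z - z') / t))"
      using that t X
      by (intro mult_left_mono dser_lipschitz)
         (auto simp: norm_divide field_simps simp flip: diff_divide_distrib complex_cnj_diff)
    also have "\<dots> = C * R * norm (z - z')" by (simp add: C_def power2_eq_square)
    finally show ?thesis .
  qed
  have "linear L" using L(1) has_derivative_linear by blast
  moreover have "inj L" using L(2) by (simp add: bij_def)
  ultimately obtain B where B: "B > 0" "\<And>z. B * norm z \<le> norm (L z)"
    using linear_inj_bounded_below_pos by blast
  have \<Lambda>_scale: "\<Lambda> (x *\<^sub>R z) = x *\<^sub>R \<Lambda> z" for x z
    by (simp add: \<Lambda>_def scaleR_conv_of_real algebra_simps)
  \<comment> \<open>Both \<open>L\<close> and \<open>\<Lambda>\<close> approximate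
    \<open>\<Phi>\<close> near 0, so on a small ball they differ by at most half the lower bound
    \<open>B\<close> of \<open>L\<close>. Homogeneity carries the estimate to all
    \<open>z\<close>.\<close>
  have \<Lambda>_below: "B / 2 * norm z \<le> norm (\<Lambda> z)" for z
  proof -
    obtain d where d: "d > 0" "\<And>y. norm y < d \<Longrightarrow> norm (\<Phi> y - L y) \<le> B / 4 * norm y"
      using L(1) B(1) unfolding has_derivative_at_alt by (auto simp: \<Phi>0 dest!: spec[of _ "B/4"])
    define R where "R = min (min (d / 2) (t / 4)) (B / (4 * C))"
    have R: "0 < R" "R < d" "R \<le> t / 4" using d(1) t B C by (auto simp: R_def)
    have "R \<le> B / (4 * C)" by (simp add: R_def)
    then have CR: "C * R \<le> B / 4" using C by (simp add: field_simps)
    have small: "B / 2 * norm y \<le> norm (\<Lambda> y)" if "norm y \<le> R" for y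
    proof -
      have "norm (\<Phi> y - \<Lambda> y) \<le> C * R * norm y" using diff[of y R 0] that R by (simp add: \<Phi>0)
      also have "\<dots> \<le> B / 4 * norm y" using CR by (intro mult_right_mono) auto
      finally have "norm (\<Phi> y - \<Lambda> y) \<le> B / 4 * norm y" .
      moreover have "norm (\<Phi> y - L y) \<le> B / 4 * norm y" using d(2)[of y] that R by simp
      ultimately have "norm (L y - \<Lambda> y) \<le> B / 2 * norm y"
        using norm_triangle_ineq4[of "\<Phi> y - \<Lambda> y" "\<Phi> y - L y"] by simp
      then show ?thesis using B(2)[of y] norm_triangle_ineq2[of "L y" "\<Lambda> y"] by simp
    qed
    show ?thesis
    proof (cases "z = 0")
      case False
      have "B / 2 * norm ((R / norm z) *\<^sub>R z) \<le> norm (\<Lambda> ((R / norm z) *\<^sub>R z))"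
        using False R by (intro small) auto
      then show ?thesis using False R unfolding \<Lambda>_scale by (simp add: field_simps)
    qed simp
  qed
  define \<delta> where "\<delta> = min (t / 4) (B / (4 * C))"
  have \<delta>: "0 < \<delta>" "\<delta> \<le> t / 4" using t B C by (auto simp: \<delta>_def)
  have "\<delta> \<le> B / (4 * C)" by (simp add: \<delta>_def)
  then have C\<delta>: "C * \<delta> \<le> B / 4" using C by (simp add: field_simps)
  have main: "norm ((\<Phi> z - \<Phi> z') - \<Lambda> (z - z')) \<le> B / 4 * norm (z - z')"
    if "z \<in> ball 0 \<delta>" "z' \<in> ball 0 \<delta>" for z z'
  proof -
    have "norm ((\<Phi> z - \<Phi> z') - \<Lambda> (z - z')) \<le> C * \<delta> * norm (z - z')"
      using that \<delta> by (intro diff) auto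
    also have "\<dots> \<le> B / 4 * norm (z - z')" using C\<delta> by (intro mult_right_mono) auto
    finally show ?thesis .
  qed
  show ?thesis
  proof (rule that)
    show "0 < B / 4" "0 < \<delta>" using B \<delta> by auto
    show "B / 4 * norm (z - z') \<le> norm (\<Phi> z - \<Phi> z')" if "z \<in> ball 0 \<delta>" "z' \<in> ball 0 \<delta>" for z z'
      using main[OF that] \<Lambda>_below[of "z - z'"] norm_triangle_ineq2[of "\<Lambda> (z - z')" "\<Phi> z - \<Phi> z'"]
      by (simp add: norm_minus_commute)
    show "continuous_on (ball 0 \<delta>) \<Phi>"
    proof (rule lipschitz_on_continuous_on)
      show "(norm c1 + norm c2 + B / 4)-lipschitz_on (ball 0 \<delta>) \<Phi>"
      proof (rule lipschitz_onI)
        fix z z' :: complex assume z: "z \<in> ball 0 \<delta>" "z' \<in> ball 0 \<delta>"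
        have "norm (\<Lambda> (z - z')) \<le> norm c1 * norm (z - z') + norm c2 * norm (z - z')"
          unfolding \<Lambda>_def by (rule norm_triangle_le) (simp add: norm_mult flip: complex_cnj_diff)
        then show "dist (\<Phi> z) (\<Phi> z') \<le> (norm c1 + norm c2 + B / 4) * dist z z'"
          using main[OF z] norm_triangle_ineq2[of "\<Phi> z - \<Phi> z'" "\<Lambda> (z - z')"]
          by (simp add: dist_norm algebra_simps)
      qed (use B in auto)
    qed
  qed
qed

section \<open>Real functions and irrational rotations on circles\<close>

lemma no_injective_real_on_circle:
  fixes f :: "complex \<Rightarrow> real"
  assumes v: "0 < v" and f: "continuous_on (sphere 0 v) f" "inj_on f (sphere 0 v)"
  shows False
proof -
  let ?S = "sphere (0::complex) v"
  \<comment> \<open>Borsuk-Ulam in dimension one: this odd function on a connected circle has a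
    zero, where \<open>f\<close> identifies antipodal points.\<close>
  define h where "h = (\<lambda>u. f u - f (- u))"
  have "continuous_on ?S h"
    unfolding h_def
    by (intro continuous_intros f(1) continuous_on_compose2[OF f(1)]) auto
  moreover have "connected ?S" by (rule connected_sphere) simp
  ultimately have con: "connected (h ` ?S)" by (rule connected_continuous_image)
  have u: "complex_of_real v \<in> ?S" "- complex_of_real v \<in> ?S" using v by auto
  have neg: "h (- complex_of_real v) = - h (complex_of_real v)" by (simp add: h_def)
  have "0 \<in> h ` ?S"
  proof (cases "h (complex_of_real v) \<le> 0")
    case True
    then show ?thesis
      using connectedD_interval[OF con imageI[OF u(1)] imageI[OF u(2)], of 0] neg by simp
  next
    case False
    then show ?thesis
      using connectedD_interval[OF con imageI[OF u(2)] imageI[OF u(1)], of 0] neg by simp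
  qed
  then obtain x where x: "x \<in> ?S" "f x = f (- x)" by (auto simp: h_def)
  then have "x = - x" using inj_onD[OF f(2), of x "- x"] by simp
  then show False using x v by auto
qed

text \<open>Kronecker's theorem on fractional parts, carried to the circle by the bound of chords by
  arcs.\<close>

lemma dense_rotation_orbit:
  assumes irr: "\<omega> / (2 * pi) \<notin> \<rat>" and v: "0 < v" and wu: "norm w = v" "norm u = v"
  shows "u \<in> closure (range (\<lambda>n::nat. w * cis (real n * \<omega>)))"
  unfolding closure_approachable
proof (intro allI impI)
  fix e :: real assume "0 < e"
  have w0: "w \<noteq> 0" using wu v by auto
  define \<beta> where "\<beta> = frac (Arg (u / w) / (2 * pi))"
  have uw: "u = w * cis (2 * pi * \<beta>)"
  proof -
    have "norm (u / w) = 1" using wu v by (simp add: norm_divide)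
    then have "u / w = cis (Arg (u / w))" using Arg_eq[of "u / w"] by (cases "u / w = 0") (simp_all add: cis_conv_exp)
    also have "\<dots> = cis (2 * pi * \<beta>)"
    proof -
      have "2 * pi * \<beta> = Arg (u / w) - 2 * pi * of_int \<lfloor>Arg (u / w) / (2 * pi)\<rfloor>"
        by (simp add: \<beta>_def frac_def algebra_simps)
      then show ?thesis by (simp add: cis_divide[symmetric])
    qed
    finally show ?thesis using w0 by (simp add: field_simps)
  qed
  have \<beta>: "0 \<le> \<beta>" "\<beta> \<le> 1" by (auto simp: \<beta>_def frac_lt_1 less_imp_le)
  have "e / (2 * pi * v) > 0" using \<open>0 < e\<close> v by simp
  from Kronecker_approx_1_explicit[OF irr \<beta> this]
  obtain k :: nat where k: "\<bar>frac (real k * (\<omega> / (2 * pi))) - \<beta>\<bar> < e / (2 * pi * v)" by blast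
  have "cis (real k * \<omega>) = cis (2 * pi * frac (real k * (\<omega> / (2 * pi))))"
  proof -
    have "2 * pi * frac (real k * (\<omega> / (2 * pi))) = real k * \<omega> - 2 * pi * of_int \<lfloor>real k * (\<omega> / (2 * pi))\<rfloor>"
      by (simp add: frac_def algebra_simps)
    then show ?thesis by (simp add: cis_divide[symmetric])
  qed
  then have "dist (w * cis (real k * \<omega>)) u
      = v * norm (cis (2 * pi * frac (real k * (\<omega> / (2 * pi)))) - cis (2 * pi * \<beta>))"
    unfolding uw dist_norm by (simp add: norm_mult wu flip: right_diff_distrib)
  also have "\<dots> \<le> v * \<bar>2 * pi * frac (real k * (\<omega> / (2 * pi))) - 2 * pi * \<beta>\<bar>"
    using v by (intro mult_left_mono norm_cis_diff_le) auto
  also have "\<dots> = 2 * pi * v * \<bar>frac (real k * (\<omega> / (2 * pi))) - \<beta>\<bar>"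
    by (simp add: abs_mult flip: right_diff_distrib)
  also have "\<dots> < e" using k v by (simp add: field_simps)
  finally show "\<exists>y\<in>range (\<lambda>n::nat. w * cis (real n * \<omega>)). dist y u < e" by blast
qed

text \<open>The rotation number is injective in the radius, so an interval of radii cannot have only
  rational ones, by countability.\<close>

lemma exists_irrational_rotation:
  fixes a b \<alpha> :: real
  assumes "0 \<le> a" "a < b" "0 < s"
  obtains v where "a < v" "v < b" "(\<alpha> + v ^ (2 * s)) / (2 * pi) \<notin> \<rat>"
proof -
  let ?f = "\<lambda>v. (\<alpha> + v ^ (2 * s)) / (2 * pi)"
  have "inj_on ?f {a<..<b}"
    by (rule inj_onI) (use assms in \<open>auto dest: power_eq_imp_eq_base\<close>)
  then have "\<not> ?f ` {a<..<b} \<subseteq> \<rat>"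
    using uncountable_open_interval[of a b] assms countable_rat countable_subset countable_image_inj_on by blast
  then obtain v where "v \<in> {a<..<b}" "?f v \<notin> \<rat>" by blast
  then show ?thesis by (intro that[of v]) auto
qed

context sigma_point
begin

lemma conjugacy_orbit:
  assumes eq: "\<And>z. norm z < \<delta> \<Longrightarrow> \<Phi> (varphi s \<alpha> a z) = Tmap s \<alpha> (\<Phi> z)"
    and \<delta>: "\<delta> \<le> inj_radius" and z: "norm z < \<delta>"
  shows "norm ((varphi s \<alpha> a ^^ n) z) = norm z"
    and "\<Phi> ((varphi s \<alpha> a ^^ n) z) = \<Phi> z * cis (real n * (\<alpha> + norm (\<Phi> z) ^ (2 * s)))"
proof -
  show n: "norm ((varphi s \<alpha> a ^^ n) z) = norm z" for n
    by (induction n) (use z \<delta> norm_varphi in auto)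
  show "\<Phi> ((varphi s \<alpha> a ^^ n) z) = \<Phi> z * cis (real n * (\<alpha> + norm (\<Phi> z) ^ (2 * s)))"
  proof (induction n)
    case (Suc n)
    have "\<Phi> ((varphi s \<alpha> a ^^ Suc n) z) = Tmap s \<alpha> (\<Phi> ((varphi s \<alpha> a ^^ n) z))"
      using eq[of "(varphi s \<alpha> a ^^ n) z"] z n by simp
    also have "\<dots> = \<Phi> z * cis (real (Suc n) * (\<alpha> + norm (\<Phi> z) ^ (2 * s)))"
      unfolding Suc by (simp add: Tmap_eq T_angle_def norm_mult cis_mult algebra_simps)
    finally show ?case .
  qed simp
qed

text \<open>
  If \<open>|\<Phi>|\<close> is not constant on a circle \<open>S\<close>, it takes a value \<open>v\<close> for which \<open>T\<close> rotates the circle of radius \<open>v\<close>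
  by an irrational angle. Orbits are dense there, so \<open>\<Phi> ` S\<close> contains that whole circle, and the inverse of \<open>\<Phi>\<close>
  embeds it into \<open>S\<close> minus a point, hence into the line.
\<close>

lemma conjugacy_not_less:
  assumes eq: "\<And>z. norm z < \<delta> \<Longrightarrow> \<Phi> (varphi s \<alpha> a z) = Tmap s \<alpha> (\<Phi> z)"
    and \<delta>: "\<delta> \<le> inj_radius" and cont: "continuous_on (ball 0 \<delta>) \<Phi>" and inj: "inj_on \<Phi> (ball 0 \<delta>)"
    and z: "norm z1 = norm z2" "norm z2 < \<delta>"
  shows "\<not> norm (\<Phi> z1) < norm (\<Phi> z2)"
proof
  assume less: "norm (\<Phi> z1) < norm (\<Phi> z2)"
  define S where "S = sphere (0::complex) (norm z2)"
  have S: "S \<subseteq> ball 0 \<delta>" "z1 \<in> S" "z2 \<in> S" using z by (auto simp: S_def)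
  have z2: "z2 \<noteq> 0" using less z by auto
  have contS: "continuous_on S \<Phi>" and injS: "inj_on \<Phi> S"
    using cont inj S(1) by (auto intro: continuous_on_subset inj_on_subset)
  obtain v where v: "norm (\<Phi> z1) < v" "v < norm (\<Phi> z2)" "(\<alpha> + v ^ (2 * s)) / (2 * pi) \<notin> \<rat>"
    using exists_irrational_rotation[OF norm_ge_zero less s_pos] by blast
  have v0: "0 < v" using v(1) norm_ge_zero[of "\<Phi> z1"] by linarith
  have "connected ((\<lambda>z. norm (\<Phi> z)) ` S)"
    using contS unfolding S_def
    by (intro connected_continuous_image continuous_intros connected_sphere) auto
  from connectedD_interval[OF this imageI[OF S(2)] imageI[OF S(3)], of v] v
  obtain z3 where z3: "z3 \<in> S" "norm (\<Phi> z3) = v" by auto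
  have "range (\<lambda>n::nat. \<Phi> z3 * cis (real n * (\<alpha> + v ^ (2 * s)))) \<subseteq> \<Phi> ` S"
  proof (rule image_subsetI)
    fix n :: nat
    show "\<Phi> z3 * cis (real n * (\<alpha> + v ^ (2 * s))) \<in> \<Phi> ` S"
      using conjugacy_orbit[where \<Phi> = \<Phi>, OF eq \<delta>, of z3 n] z3 S z
      by (intro image_eqI[of _ _ "(varphi s \<alpha> a ^^ n) z3"]) (auto simp: S_def)
  qed
  moreover have "closed (\<Phi> ` S)"
    unfolding S_def by (intro compact_imp_closed compact_continuous_image contS[unfolded S_def] compact_sphere)
  ultimately have "closure (range (\<lambda>n::nat. \<Phi> z3 * cis (real n * (\<alpha> + v ^ (2 * s))))) \<subseteq> \<Phi> ` S"
    by (rule closure_minimal)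
  then have sub: "sphere 0 v \<subseteq> \<Phi> ` S"
    using dense_rotation_orbit[OF v(3) v0 z3(2)] by (auto simp: subset_iff)
  define G where "G = inv_into S \<Phi>"
  have contG: "continuous_on (sphere 0 v) G"
  proof (rule continuous_on_subset[OF _ sub])
    show "continuous_on (\<Phi> ` S) G"
      by (rule continuous_on_inv[OF contS]) (auto simp: S_def G_def inv_into_f_f[OF injS[unfolded S_def]])
  qed
  have G: "G u \<in> S" "\<Phi> (G u) = u" if "u \<in> sphere 0 v" for u
    using sub that by (auto simp: G_def inv_into_into f_inv_into_f subset_iff)
  have n1: "norm (- (G u / z2)) = 1" if "u \<in> sphere 0 v" for u
    using G(1)[OF that] z2 by (simp add: S_def norm_divide)
  \<comment> \<open>The point \<open>z2\<close> is missed by \<open>G\<close> because the modulus of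
    its image exceeds \<open>v\<close>. Dividing by \<open>- z2\<close> moves the missed point to
    -1, on the branch cut of \<open>Arg\<close>.\<close>
  have avoid: "- (G u / z2) \<notin> \<real>\<^sub>\<le>\<^sub>0" if "u \<in> sphere 0 v" for u
  proof
    assume "- (G u / z2) \<in> \<real>\<^sub>\<le>\<^sub>0"
    then have "Im (G u / z2) = 0" "0 \<le> Re (G u / z2)" by (auto simp: complex_nonpos_Reals_iff)
    moreover from this have "norm (G u / z2) = Re (G u / z2)"
      by (simp add: cmod_eq_Re)
    ultimately have "G u / z2 = 1" using n1[OF that] by (simp add: complex_eq_iff)
    then have "u = \<Phi> z2" using G(2)[OF that] z2 by simp
    then show False using that v(2) by simp
  qed
  have "inj_on (\<lambda>u. Arg (- (G u / z2))) (sphere 0 v)"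
  proof (rule inj_onI)
    fix u u' assume u: "u \<in> sphere 0 v" "u' \<in> sphere 0 v" and A: "Arg (- (G u / z2)) = Arg (- (G u' / z2))"
    have "- (G u / z2) \<noteq> 0" "- (G u' / z2) \<noteq> 0" using n1[OF u(1)] n1[OF u(2)] by auto
    then have "- (G u / z2) = - (G u' / z2)"
      using Arg_eq[of "- (G u / z2)"] Arg_eq[of "- (G u' / z2)"] n1[OF u(1)] n1[OF u(2)] A by simp
    then have "G u = G u'" using z2 by simp
    then show "u = u'" using G(2) u by metis
  qed
  moreover have "continuous_on (sphere 0 v) (\<lambda>u. Arg (- (G u / z2)))"
    using z2 avoid by (intro continuous_intros contG) auto
  ultimately show False using no_injective_real_on_circle[OF v0] by blast
qed

text \<open>Since \<open>\<bar>\<Phi>\<bar>\<close> is constant on circles, one whole circle of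
  radius \<open>\<rho>\<close> is mapped into the circle of radius \<open>r\<close>, where
  \<open>T\<close> has period \<open>q\<close>. Injectivity of \<open>\<Phi>\<close> returns the
  periodicity to \<open>varphi\<close>, and \<open>h\<close> depends on \<open>\<rho>\<close> but
  not on the angle.\<close>

lemma conjugacy_imp_common_solution:
  assumes conv: "conv_transf \<Phi>"
    and conj: "\<forall>\<^sub>F z in nhds 0. \<Phi> (varphi s \<alpha> a z) = Tmap s \<alpha> (\<Phi> z)"
  shows "\<exists>C \<epsilon>. 0 < \<epsilon> \<and> (\<forall>p q r w. rs_data s q r \<longrightarrow> w = 2 * pi * of_int p / real q \<longrightarrow>
       r ^ (2 * s) = w - \<alpha> \<longrightarrow> r < \<epsilon> \<longrightarrow> C * r \<le> 1/16 \<longrightarrow> C * (real q * r ^ (2 * s)) \<le> 1 \<longrightarrow>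
       (\<exists>h. \<forall>th. \<exists>d. rs_system.solution s q r w th \<i> trunc h d))"
proof -
  have \<Phi>0: "\<Phi> 0 = 0" using conv by (simp add: conv_transf_def)
  obtain c \<delta>1 where c: "0 < c" "0 < \<delta>1" "continuous_on (ball 0 \<delta>1) \<Phi>"
    and low: "\<And>z z'. z \<in> ball 0 \<delta>1 \<Longrightarrow> z' \<in> ball 0 \<delta>1 \<Longrightarrow> c * norm (z - z') \<le> norm (\<Phi> z - \<Phi> z')"
    using conv_transf_bilipschitz[OF conv] by blast
  obtain \<delta>2 where \<delta>2: "0 < \<delta>2" "\<And>z. norm z < \<delta>2 \<Longrightarrow> \<Phi> (varphi s \<alpha> a z) = Tmap s \<alpha> (\<Phi> z)"
    using conj unfolding eventually_nhds_metric by (auto simp: dist_norm)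
  define \<delta> where "\<delta> = min (min \<delta>1 \<delta>2) inj_radius"
  have \<delta>: "0 < \<delta>" "\<delta> \<le> \<delta>1" "\<delta> \<le> \<delta>2" "\<delta> \<le> inj_radius" using c \<delta>2 inj_radius by (auto simp: \<delta>_def)
  have eq: "\<Phi> (varphi s \<alpha> a z) = Tmap s \<alpha> (\<Phi> z)" if "norm z < \<delta>" for z using \<delta>2(2) that \<delta> by simp
  have cont: "continuous_on (ball 0 \<delta>) \<Phi>" by (rule continuous_on_subset[OF c(3)]) (use \<delta> in auto)
  have inj: "inj_on \<Phi> (ball 0 \<delta>)"
  proof (rule inj_onI)
    fix z z' assume "z \<in> ball 0 \<delta>" "z' \<in> ball 0 \<delta>" "\<Phi> z = \<Phi> z'"
    then have "c * norm (z - z') \<le> 0" using low[of z z'] \<delta> by auto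
    then show "z = z'" using c(1) by (simp add: mult_le_0_iff)
  qed
  have radial: "norm (\<Phi> z) = norm (\<Phi> z')" if "norm z = norm z'" "norm z' < \<delta>" for z z'
    using conjugacy_not_less[where \<Phi> = \<Phi>, OF eq \<delta>(4) cont inj, of z z'] conjugacy_not_less[where \<Phi> = \<Phi>, OF eq \<delta>(4) cont inj, of z' z] that
    by simp
  \<comment> \<open>The lower Lipschitz bound gives \<open>\<rho> \<le> r / c\<close>; the maximum
    with 1 lets a single power of \<open>M\<close> serve both exponents \<open>2 * s\<close> and
    \<open>2 * s + 1\<close>.\<close>
  define M where "M = max 1 (1 / c)"
  define C where "C = K * M ^ (2 * s + 1)"
  have M: "1 \<le> M" "1 / c \<le> M" by (auto simp: M_def)
  show ?thesis
  proof (rule exI[of _ C], rule exI[of _ "c * (\<delta> / 2)"], intro conjI allI impI)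
    show "0 < c * (\<delta> / 2)" using c \<delta> by simp
    fix p q r w
    assume rs: "rs_data s q r" and w: "w = 2 * pi * of_int p / real q" and rw: "r ^ (2 * s) = w - \<alpha>"
      and r: "r < c * (\<delta> / 2)" and Cr: "C * r \<le> 1/16" and Cq: "C * (real q * r ^ (2 * s)) \<le> 1"
    interpret rs_data s q r by (rule rs)
    \<comment> \<open>The bound \<open>c * (\<delta> / 2)\<close> on \<open>r\<close> is what makes
      the modulus of \<open>\<Phi>\<close> pass the value \<open>r\<close> between 0 and
      \<open>\<delta> / 2\<close>.\<close>
    have "\<exists>\<rho>\<ge>0. \<rho> \<le> \<delta> / 2 \<and> norm (\<Phi> (of_real \<rho>)) = r"
    proof (rule IVT')
      show "norm (\<Phi> (of_real 0)) \<le> r" using r_pos by (simp add: \<Phi>0)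
      have "c * norm (of_real (\<delta> / 2) - 0 :: complex) \<le> norm (\<Phi> (of_real (\<delta> / 2)) - \<Phi> 0)"
        using \<delta> by (intro low) auto
      then show "r \<le> norm (\<Phi> (of_real (\<delta> / 2)))" using r \<delta> by (simp add: \<Phi>0)
      show "continuous_on {0..\<delta> / 2} (\<lambda>x. norm (\<Phi> (of_real x)))"
        using \<delta> by (intro continuous_intros continuous_on_compose2[OF cont]) auto
    qed (use \<delta> in auto)
    then obtain \<rho> where \<rho>: "0 \<le> \<rho>" "\<rho> \<le> \<delta> / 2" "norm (\<Phi> (of_real \<rho>)) = r" by blast
    have \<rho>\<delta>: "\<rho> < \<delta>" using \<rho> \<delta> by simp
    have \<rho>0: "0 < \<rho>" using \<rho> r_pos by (cases "\<rho> = 0") (auto simp: \<Phi>0)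
    have "c * norm (of_real \<rho> - 0 :: complex) \<le> norm (\<Phi> (of_real \<rho>) - \<Phi> 0)"
      using \<rho>\<delta> \<rho>0 \<delta> by (intro low) auto
    then have "c * \<rho> \<le> r" using \<rho> by (simp add: \<Phi>0)
    then have "\<rho> \<le> (1 / c) * r" using c by (simp add: field_simps)
    also have "\<dots> \<le> M * r" using M r_pos by (intro mult_right_mono) auto
    finally have \<rho>M: "\<rho> \<le> M * r" .
    have Mp: "\<rho> ^ n \<le> M ^ n * r ^ n" for n
      using power_mono[OF \<rho>M \<rho>(1), of n] by (simp add: power_mult_distrib)
    have C1: "\<rho> ^ (2 * s) \<le> C * r ^ (2 * s)"
    proof -
      have "M ^ (2 * s) \<le> 1 * M ^ (2 * s + 1)" using power_increasing[of "2 * s" "2 * s + 1" M] M by simp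
      also have "\<dots> \<le> C" unfolding C_def using K_ge M by (intro mult_right_mono) auto
      finally have "M ^ (2 * s) * r ^ (2 * s) \<le> C * r ^ (2 * s)" using r_pos by (intro mult_right_mono) auto
      then show ?thesis using Mp[of "2 * s"] by linarith
    qed
    have C2: "K * \<rho> ^ (2 * s + 1) \<le> C * r ^ (2 * s + 1)"
      using mult_left_mono[OF Mp[of "2 * s + 1"], of K] K_ge by (simp add: C_def ac_simps)
    have per: "(varphi s \<alpha> a ^^ q) z = z" if z: "norm z = \<rho>" for z
    proof -
      have "norm (\<Phi> z) = r" using radial[of z "of_real \<rho>"] z \<rho> \<rho>\<delta> by simp
      then have "\<Phi> ((varphi s \<alpha> a ^^ q) z) = \<Phi> z * cis (real q * w)"
        using conjugacy_orbit(2)[where \<Phi> = \<Phi>, OF eq \<delta>(4), of z q] z \<rho>\<delta> rw by simp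
      also have "real q * w = 2 * pi * of_int p" using q_pos by (simp add: w)
      finally have "\<Phi> ((varphi s \<alpha> a ^^ q) z) = \<Phi> z" by simp
      moreover have "norm ((varphi s \<alpha> a ^^ q) z) = norm z"
        using z \<rho>\<delta> by (intro conjugacy_orbit(1)[where \<Phi> = \<Phi>, OF eq \<delta>(4)]) simp_all
      ultimately show ?thesis
        using inj_onD[OF inj, of "(varphi s \<alpha> a ^^ q) z" z] z \<rho>\<delta> by simp
    qed
    have "\<exists>d. rs_system.solution s q r w th \<i> trunc (of_real (2 * real s * ln (\<rho> / r))) d" for th
    proof (rule periodic_imp_solution[OF rs w rw \<rho>0 _ _ C1 C2 Cr Cq])
      show "\<rho> < inj_radius" using \<rho>\<delta> \<delta> by simp
      show "(varphi s \<alpha> a ^^ q) (base (of_real \<rho> * cis th)) = base (of_real \<rho> * cis th)"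
        using \<rho>0 by (intro per) (simp add: norm_mult)
    qed
    then show "\<exists>h. \<forall>th. \<exists>d. rs_system.solution s q r w th \<i> trunc h d" by blast
  qed
qed

end

section \<open>The obstructions\<close>

text \<open>At the angles \<open>pi / q\<close> and 0 the resonant factor
  \<open>cos (q * th)\<close> is -1 and 1, so the difference keeps a nonzero linear coefficient.
  Deleting monomials with variables outside \<open>idx s\<close> corresponds to evaluating at
  \<open>trunc\<close>.\<close>

definition rs_ps :: "nat \<Rightarrow> nat \<Rightarrow> real \<Rightarrow> real \<Rightarrow> ps" where
  "rs_ps s q r w m = (if Poly_Mapping.keys m \<subseteq> idx s
     then coef (rs_h s q r w (pi / real q) - rs_h s q r w 0) m else 0)"

lemma ps_vars_in_rs_ps: "ps_vars_in (idx s) (rs_ps s q r w)"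
  by (auto simp: ps_vars_in_def rs_ps_def)

context sigma_point
begin

lemma rs_ps_monom:
  "rs_ps s q r w m * ps_monom a m = coef (rs_h s q r w (pi / real q) - rs_h s q r w 0) m * ps_monom trunc m"
proof (cases "Poly_Mapping.keys m \<subseteq> idx s")
  case True
  then have "ps_monom a m = ps_monom trunc m"
    unfolding ps_monom_def by (intro prod.cong) (auto simp: trunc_def)
  then show ?thesis using True by (simp add: rs_ps_def)
next
  case False
  then obtain v where "v \<in> Poly_Mapping.keys m" "v \<notin> idx s" by blast
  then have "ps_monom trunc m = 0"
    unfolding ps_monom_def by (intro prod_zero bexI[of _ v]) (auto simp: trunc_def in_keys_iff)
  then show ?thesis using False by (simp add: rs_ps_def)
qed

lemma ps_converges_at_rs_ps: "ps_converges_at (rs_ps s q r w) a"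
  unfolding ps_converges_at_def rs_ps_monom by (rule ps_eval_summable[OF norm_trunc_le])

lemma ps_eval_rs_ps_eq_0:
  assumes rs: "rs_data s q r" and sol: "\<And>th. \<exists>d. rs_system.solution s q r w th \<i> trunc h d"
  shows "ps_eval (rs_ps s q r w) a = 0"
proof -
  interpret rs_data s q r by (rule rs)
  interpret bounded_linear "\<lambda>f. ps_eval (coef f) trunc" by (rule bounded_linear_ps_eval[OF norm_trunc_le])
  have h: "ps_eval (coef (rs_h s q r w th)) trunc = h" for th
    using ps_eval_rs_h[of trunc, OF norm_trunc_le] sol by blast
  have "ps_eval (rs_ps s q r w) a = ps_eval (coef (rs_h s q r w (pi / real q) - rs_h s q r w 0)) trunc"
    unfolding ps_eval_def rs_ps_monom ..
  also have "\<dots> = 0" unfolding diff h by simp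
  finally show ?thesis .
qed

end

section \<open>Linear coefficients and functional independence\<close>

lemma rs_ps_single:
  assumes "rs_data s q r" and n: "2 * s < n" and w: "w = 2 * pi * of_int p / real q" and cop: "coprime p (int q)"
  shows "\<not> q dvd n \<Longrightarrow> rs_ps s q r w (Poly_Mapping.single (n, 0) 1) = 0"
    and "n = q \<Longrightarrow> rs_ps s q r w (Poly_Mapping.single (n, 0) 1) \<noteq> 0"
proof -
  interpret rs_data s q r by fact
  have "rs_ps s q r w (Poly_Mapping.single (n, 0) 1)
      = coef (rs_h s q r w (pi / real q)) (Poly_Mapping.single (n, 0) 1) - coef (rs_h s q r w 0) (Poly_Mapping.single (n, 0) 1)"
    using n by (simp add: rs_ps_def idx_def minus_ell1.rep_eq)
  also have "\<dots> = (if q dvd n then of_real (2 * r ^ n / r ^ (2 * s) * (1 - cos (real n * (pi / real q)))) else 0)"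
    unfolding coef_rs_h_single[OF n w cop] by (cases "q dvd n") (simp_all add: algebra_simps diff_divide_distrib del: One_nat_def)
  finally have eq: "rs_ps s q r w (Poly_Mapping.single (n, 0) 1)
      = (if q dvd n then of_real (2 * r ^ n / r ^ (2 * s) * (1 - cos (real n * (pi / real q)))) else 0)" .
  show "\<not> q dvd n \<Longrightarrow> rs_ps s q r w (Poly_Mapping.single (n, 0) 1) = 0" unfolding eq by simp
  show "n = q \<Longrightarrow> rs_ps s q r w (Poly_Mapping.single (n, 0) 1) \<noteq> 0"
    unfolding eq using r_pos q_pos by simp
qed

lemma ps_mult_0: "ps_mult f g 0 = f 0 * g 0"
proof -
  have z: "m1 = 0 \<and> m2 = 0" if "m1 + m2 = 0" for m1 m2 :: mon
    using that by (simp add: poly_mapping_eq_iff fun_eq_iff plus_poly_mapping.rep_eq)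
  have "{(m1 :: mon, m2). m1 + m2 = 0} = {(0, 0)}" by (auto dest: z)
  then show ?thesis by (simp add: ps_mult_def)
qed

lemma ps_prodl_0: "ps_prodl (map f [0..<n]) 0 = (\<Prod>k<n. f k 0)"
proof -
  have "ps_prodl (map f xs) 0 = prod_list (map (\<lambda>k. f k 0) xs)" for xs
    by (induction xs) (auto simp: ps_one_def ps_mult_0)
  then show ?thesis by (simp add: prod.list_conv_set_nth atLeast0LessThan)
qed

text \<open>The constant term of the Jacobian determinant is the determinant of the linear
  coefficients. Every permutation other than the identity sends some \<open>k\<close> below itself
  and picks a zero entry, so only the diagonal product survives.\<close>

lemma ps_func_indep_seq_triangular:
  assumes v: "inj v" "range v \<subseteq> V"
    and tri: "\<And>k l. l < k \<Longrightarrow> H k (Poly_Mapping.single (v l) 1) = 0"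
    and diag: "\<And>k. H k (Poly_Mapping.single (v k) 1) \<noteq> 0"
  shows "ps_func_indep_seq V H"
  unfolding ps_func_indep_seq_def ps_func_indep_fin_def
proof (intro allI exI conjI)
  fix n
  show "inj_on v {..<n}" "v ` {..<n} \<subseteq> V" using v by (auto intro: inj_on_subset)
  define t where "t p = of_int (sign p) * (\<Prod>k<n. H k (Poly_Mapping.single (v (p k)) 1))" for p
  have "ps_jac_det H v n 0 = (\<Sum>p\<in>{p. p permutes {..<n}}. t p)"
    unfolding ps_jac_det_def ps_prodl_0 ps_deriv_def t_def by simp
  also have "\<dots> = (\<Sum>p\<in>{id}. t p)"
  proof (rule sum.mono_neutral_right)
    show "finite {p. p permutes {..<n}}" by (rule finite_permutations) simp
    show "{id} \<subseteq> {p. p permutes {..<n}}" by (simp add: permutes_id)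
    show "\<forall>p\<in>{p. p permutes {..<n}} - {id}. t p = 0"
    proof
      fix p assume "p \<in> {p. p permutes {..<n}} - {id}"
      then have "\<not> (\<forall>k\<in>{..<n}. k \<le> p k)" using permutes_natset_ge[of p "{..<n}"] by blast
      then obtain k where "k < n" "p k < k" by (auto simp: not_le)
      then show "t p = 0" using tri[of "p k" k] by (auto simp: t_def intro!: prod_zero bexI[of _ k])
    qed
  qed
  also have "\<dots> \<noteq> 0" using diag by (simp add: t_def sign_id)
  finally show "ps_jac_det H v n \<noteq> (\<lambda>_. 0)" by (metis (no_types))
qed

text \<open>Density of fractional parts yields \<open>h\<close> and \<open>k\<close> with
  \<open>h - k * \<beta>\<close> positive and below \<open>\<eta>\<close>. Dividing by the gcd only
  decreases this distance, and \<open>\<eta>\<close> is at most every gap to the next integer for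
  denominators up to \<open>N\<close>, which forces \<open>q > N\<close>.\<close>

lemma coprime_approximation_above:
  fixes \<alpha> e :: real
  assumes irr: "\<alpha> / (2 * pi) \<notin> \<rat>" and e: "0 < e"
  shows "\<exists>p q. N < q \<and> coprime p (int q) \<and> 0 < 2 * pi * of_int p - real q * \<alpha> \<and> 2 * pi * of_int p - real q * \<alpha> < e"
proof -
  define \<beta> where "\<beta> = \<alpha> / (2 * pi)"
  define \<eta> where "\<eta> = Min (insert (e / (2 * pi)) ((\<lambda>q. of_int \<lceil>real q * \<beta>\<rceil> - real q * \<beta>) ` {1..N}))"
  have gap: "0 < of_int \<lceil>real q * \<beta>\<rceil> - real q * \<beta>" if "q \<in> {1..N}" for q
  proof -
    have "real q * \<beta> \<noteq> of_int \<lceil>real q * \<beta>\<rceil>"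
    proof
      assume "real q * \<beta> = of_int \<lceil>real q * \<beta>\<rceil>"
      then have "\<beta> = of_int \<lceil>real q * \<beta>\<rceil> / of_nat q" using that by (simp add: field_simps)
      then have "\<beta> \<in> \<rat>" by (metis Rats_divide Rats_of_int Rats_of_nat)
      then show False using irr by (simp add: \<beta>_def)
    qed
    then show ?thesis using le_of_int_ceiling[of "real q * \<beta>"] by linarith
  qed
  have \<eta>: "0 < \<eta>" using gap e by (simp add: \<eta>_def)
  have \<eta>e: "\<eta> \<le> e / (2 * pi)" and \<eta>q: "\<And>q. q \<in> {1..N} \<Longrightarrow> \<eta> \<le> of_int \<lceil>real q * \<beta>\<rceil> - real q * \<beta>"
    unfolding \<eta>_def by (rule Min_le; simp)+
  \<comment> \<open>Target \<open>- \<eta> / 2\<close> with tolerance \<open>\<eta> / 2\<close>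
    forces \<open>k * \<beta> - h\<close> to lie strictly between \<open>- \<eta>\<close> and 0, so
    the approximation is from above.\<close>
  obtain h k :: int where k: "k > 0" and hk: "\<bar>of_int k * \<beta> - of_int h - (- \<eta> / 2)\<bar> < \<eta> / 2"
    using sequence_of_fractional_parts_is_dense[of \<beta> "\<eta> / 2" "- \<eta> / 2"] irr \<eta> unfolding \<beta>_def by (metis half_gt_zero)
  define g where "g = gcd h k"
  have g: "g > 0" "h = h div g * g" "k = k div g * g" using k by (auto simp: g_def)
  have kg: "k div g > 0" using k g by (metis zero_less_mult_pos2)
  define q where "q = nat (k div g)"
  have q: "int q = k div g" "0 < q" using kg by (auto simp: q_def)
  have "coprime (h div g) (k div g)" using k unfolding g_def by (intro div_gcd_coprime) auto
  then have cop: "coprime (h div g) (int q)" by (simp add: q)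
  define x where "x = of_int (h div g) - real q * \<beta>"
  have "of_int h - of_int k * \<beta> = of_int g * x"
  proof -
    have "real q = of_int (k div g)" using q(1) by (metis of_int_of_nat_eq)
    then show ?thesis
      using arg_cong[OF g(2), of real_of_int] arg_cong[OF g(3), of real_of_int] by (simp add: x_def algebra_simps)
  qed
  moreover have "0 < of_int h - of_int k * \<beta>" "of_int h - of_int k * \<beta> < \<eta>" using hk by linarith+
  ultimately have gx: "0 < of_int g * x" "of_int g * x < \<eta>" by auto
  have x0: "0 < x" using gx(1) g(1) by (simp add: zero_less_mult_iff)
  have "1 * x \<le> of_int g * x" using g(1) x0 by (intro mult_right_mono) auto
  then have x\<eta>: "x < \<eta>" using gx(2) by simp
  have "N < q"
  proof (rule ccontr)
    assume "\<not> N < q"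
    then have "\<eta> \<le> of_int \<lceil>real q * \<beta>\<rceil> - real q * \<beta>" using q by (intro \<eta>q) auto
    also have "\<dots> \<le> x" using x0 by (simp add: x_def ceiling_le_iff)
    finally show False using x\<eta> by simp
  qed
  moreover have "2 * pi * of_int (h div g) - real q * \<alpha> = 2 * pi * x" by (simp add: x_def \<beta>_def algebra_simps)
  moreover have "2 * pi * x < e"
  proof -
    have "2 * pi * x < 2 * pi * \<eta>" using x\<eta> by simp
    also have "\<dots> \<le> e" using \<eta>e by (simp add: field_simps)
    finally show ?thesis .
  qed
  ultimately show ?thesis using x0 cop by (intro exI[of _ "h div g"] exI[of _ q]) simp
qed

section \<open>Construction of the sequence\<close>

theorem theorem1p1:
  fixes s :: nat and \<alpha> :: real
  assumes "s > 0" and "\<alpha> / (2 * pi) \<notin> \<rat>"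
  shows "\<exists>H :: nat \<Rightarrow> ps.
     (\<forall>k. ps_vars_in (idx s) (H k)) \<and>
     ps_func_indep_seq (idx s) H \<and>
     (\<forall>k. \<forall>a\<in>Sigma_set s. ps_converges_at (H k) a) \<and>
     (\<forall>a\<in>Sigma_set s. infinite {k. ps_eval (H k) a \<noteq> 0} \<longrightarrow>
        \<not> (\<exists>\<Phi>. conv_transf \<Phi> \<and>
              (\<forall>\<^sub>F z in nhds 0. \<Phi> (varphi s \<alpha> a z) = Tmap s \<alpha> (\<Phi> z))))"
proof -
  \<comment> \<open>The factor with \<open>rs_const s\<close> secures \<open>r_small\<close> for
    every \<open>k\<close>; the factor \<open>1 / (k + 1)\<close> eventually beats the constants
    \<open>C\<close> and \<open>\<epsilon>\<close>, which depend on \<open>a\<close> and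
    \<open>\<Phi>\<close>.\<close>
  define b where "b k = 1 / (16 * rs_const s * (real k + 1))" for k :: nat
  define \<kappa> where "\<kappa> p q = 2 * pi * of_int p - real q * \<alpha>" for p :: int and q :: nat
  have c1: "1 \<le> 16 * rs_const s"
  proof -
    have "(1::real) * 1 * 1 \<le> 18 * 16 ^ (s + 1) * 9 ^ s" by (intro mult_mono one_le_power) auto
    then show ?thesis by (simp add: rs_const_def)
  qed
  have b: "0 < b k" "b k \<le> 1 / (real k + 1)" "rs_const s * b k \<le> 1/16" for k
  proof -
    have "1 * (real k + 1) \<le> 16 * rs_const s * (real k + 1)" using c1 by (intro mult_right_mono) auto
    then show "b k \<le> 1 / (real k + 1)" unfolding b_def by (intro divide_left_mono) (auto intro!: mult_pos_pos)
    show "0 < b k" using c1 by (auto simp: b_def intro!: divide_pos_pos mult_pos_pos)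
    have "rs_const s * b k = 1 / 16 * (1 / (real k + 1))" using c1 by (simp add: b_def)
    also have "\<dots> \<le> 1 / 16 * 1" by (intro mult_left_mono) auto
    finally show "rs_const s * b k \<le> 1/16" by simp
  qed
  \<comment> \<open>Bounding \<open>\<kappa>\<close> by \<open>b k ^ (2 * s)\<close> controls both
    quantities needed later: the radius, a \<open>2 * s\<close>-th root of
    \<open>\<kappa> / q\<close>, is below \<open>b k\<close>, and
    \<open>q * r ^ (2 * s) = \<kappa>\<close> is at most \<open>b k\<close>.\<close>
  have "\<exists>f. \<forall>k. (case f k of (p, q) \<Rightarrow> 2 * s < q \<and> coprime p (int q) \<and> 0 < \<kappa> p q \<and> \<kappa> p q < b k ^ (2 * s))
      \<and> snd (f k) < snd (f (Suc k))"
  proof (rule dependent_nat_choice, goal_cases)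
    case 1
    show ?case using coprime_approximation_above[OF assms(2), of "b 0 ^ (2 * s)" "2 * s"] b by (auto simp: \<kappa>_def)
  next
    case (2 x k)
    obtain p q where "max (2 * s) (snd x) < q" "coprime p (int q)" "0 < \<kappa> p q" "\<kappa> p q < b (Suc k) ^ (2 * s)"
      using coprime_approximation_above[OF assms(2), of "b (Suc k) ^ (2 * s)" "max (2 * s) (snd x)"] b
      by (auto simp: \<kappa>_def)
    then show ?case by (intro exI[of _ "(p, q)"]) auto
  qed
  then obtain f where F: "\<forall>k. (case f k of (p, q) \<Rightarrow> 2 * s < q \<and> coprime p (int q) \<and> 0 < \<kappa> p q \<and> \<kappa> p q < b k ^ (2 * s))
      \<and> snd (f k) < snd (f (Suc k))" ..
  have f: "\<And>k. case f k of (p, q) \<Rightarrow> 2 * s < q \<and> coprime p (int q) \<and> 0 < \<kappa> p q \<and> \<kappa> p q < b k ^ (2 * s)"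
    and fS: "\<And>k. snd (f k) < snd (f (Suc k))" using F by simp_all
  define p where "p k = fst (f k)" for k
  define q where "q k = snd (f k)" for k
  have q: "2 * s < q k" "coprime (p k) (int (q k))" "0 < \<kappa> (p k) (q k)" "\<kappa> (p k) (q k) < b k ^ (2 * s)" for k
    using f[of k] by (auto simp: p_def q_def split: prod.splits)
  have mono: "strict_mono q" using fS by (intro strict_monoI_Suc) (simp add: q_def)
  define w where "w k = 2 * pi * of_int (p k) / real (q k)" for k
  define r where "r k = root (2 * s) (\<kappa> (p k) (q k) / real (q k))" for k
  have rpow: "r k ^ (2 * s) = \<kappa> (p k) (q k) / real (q k)" for k
    unfolding r_def using q[of k] assms(1) by (intro real_root_pow_pos2) auto
  have r0: "0 < r k" for k unfolding r_def using q[of k] assms(1) by (intro real_root_gt_zero) auto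
  have qr: "real (q k) * r k ^ (2 * s) = \<kappa> (p k) (q k)" for k using q(1)[of k] by (simp add: rpow)
  have rw: "r k ^ (2 * s) = w k - \<alpha>" for k
    unfolding rpow using q(1)[of k] by (simp add: w_def \<kappa>_def field_simps)
  have b1: "b k \<le> 1" for k using b(2)[of k] by (rule order_trans) simp
  have rb: "r k < b k" for k
  proof (rule power_less_imp_less_base)
    have "r k ^ (2 * s) \<le> \<kappa> (p k) (q k) / 1"
      unfolding rpow using q[of k] by (intro divide_left_mono) auto
    then show "r k ^ (2 * s) < b k ^ (2 * s)" using q(4)[of k] by simp
  qed (use b in \<open>auto intro: less_imp_le\<close>)
  have \<kappa>b: "\<kappa> (p k) (q k) \<le> b k" for k
  proof -
    have "b k ^ (2 * s) \<le> b k ^ 1" using b1 b(1)[of k] assms(1) by (intro power_decreasing) auto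
    then show ?thesis using q(4)[of k] by simp
  qed
  have rs: "rs_data s (q k) (r k)" for k
  proof
    have "rs_const s * r k \<le> rs_const s * b k" using rb[of k] c1 by (intro mult_left_mono) auto
    then show "rs_const s * r k \<le> 1/16" using b(3)[of k] by linarith
    show "real (q k) * r k ^ (2 * s) \<le> 1" unfolding qr using \<kappa>b[of k] b1[of k] by linarith
  qed (use assms(1) r0 q(1)[of k] in auto)
  define H where "H k = rs_ps s (q k) (r k) (w k)" for k
  show ?thesis
  proof (intro exI[of _ H] conjI allI ballI impI)
    show "ps_vars_in (idx s) (H k)" for k by (simp add: H_def ps_vars_in_rs_ps)
    show "ps_func_indep_seq (idx s) H"
    proof (rule ps_func_indep_seq_triangular[of "\<lambda>k. (q k, 0)"])
      show "inj (\<lambda>k. (q k, 0::nat))" using strict_mono_imp_inj_on[OF mono] by (auto simp: inj_on_def)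
      show "range (\<lambda>k. (q k, 0)) \<subseteq> idx s" using q(1) by (auto simp: idx_def)
      show "H k (Poly_Mapping.single (q l, 0) 1) = 0" if "l < k" for k l
      proof -
        have "q l < q k" using that mono by (simp add: strict_mono_def)
        then have "\<not> q k dvd q l" using q(1)[of l] by (auto dest: dvd_imp_le)
        then show ?thesis unfolding H_def by (rule rs_ps_single(1)[OF rs q(1) w_def q(2)])
      qed
      show "H k (Poly_Mapping.single (q k, 0) 1) \<noteq> 0" for k
        unfolding H_def by (rule rs_ps_single(2)[OF rs q(1) w_def q(2) refl])
    qed
  next
    fix k a assume "a \<in> Sigma_set s"
    then interpret sigma_point s a using assms(1) by unfold_locales
    show "ps_converges_at (H k) a" unfolding H_def by (rule ps_converges_at_rs_ps)
  next
    fix a assume "a \<in> Sigma_set s" and inf: "infinite {k. ps_eval (H k) a \<noteq> 0}"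
    then interpret sigma_point s a using assms(1) by unfold_locales
    show "\<not> (\<exists>\<Phi>. conv_transf \<Phi> \<and> (\<forall>\<^sub>F z in nhds 0. \<Phi> (varphi s \<alpha> a z) = Tmap s \<alpha> (\<Phi> z)))"
    proof
      assume "\<exists>\<Phi>. conv_transf \<Phi> \<and> (\<forall>\<^sub>F z in nhds 0. \<Phi> (varphi s \<alpha> a z) = Tmap s \<alpha> (\<Phi> z))"
      then obtain \<Phi> where \<Phi>: "conv_transf \<Phi>" "\<forall>\<^sub>F z in nhds 0. \<Phi> (varphi s \<alpha> a z) = Tmap s \<alpha> (\<Phi> z)"
        by blast
      obtain C \<epsilon> where \<epsilon>: "0 < \<epsilon>"
        and sol: "\<forall>p q r w. rs_data s q r \<longrightarrow> w = 2 * pi * of_int p / real q \<longrightarrow>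
          r ^ (2 * s) = w - \<alpha> \<longrightarrow> r < \<epsilon> \<longrightarrow> C * r \<le> 1/16 \<longrightarrow> C * (real q * r ^ (2 * s)) \<le> 1 \<longrightarrow>
          (\<exists>h. \<forall>th. \<exists>d. rs_system.solution s q r w th \<i> trunc h d)"
        using conjugacy_imp_common_solution[OF \<Phi>] by (elim exE conjE)
      \<comment> \<open>From \<open>N\<close> on, all smallness conditions for this \<open>a\<close>
        and \<open>\<Phi>\<close> hold, so only finitely many \<open>H k\<close> can be nonzero at
        \<open>a\<close>.\<close>
      obtain N :: nat where N: "max (1 / \<epsilon>) (16 * \<bar>C\<bar>) < real N" using reals_Archimedean2 by blast
      have "ps_eval (H k) a = 0" if k: "N \<le> k" for k
      proof -
        have Nk: "1 / \<epsilon> \<le> real k + 1" "16 * \<bar>C\<bar> \<le> real k + 1" using N k by auto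
        have bk: "b k * (real k + 1) \<le> 1" using b(2)[of k] by (simp add: field_simps)
        have small: "C * x \<le> 1/16" if "0 \<le> x" "x \<le> b k" for x
        proof -
          have "16 * (C * x) \<le> (16 * \<bar>C\<bar>) * x" using that mult_right_mono[of C "\<bar>C\<bar>" x] by simp
          also have "\<dots> \<le> (real k + 1) * b k" using that Nk by (intro mult_mono) auto
          finally show ?thesis using bk by (simp add: mult.commute)
        qed
        have "b k \<le> \<epsilon>"
        proof -
          have "b k * (1 / \<epsilon>) \<le> b k * (real k + 1)" using Nk b(1)[of k] by (intro mult_left_mono) auto
          then have "b k * (1 / \<epsilon>) \<le> 1" using bk by linarith
          then show ?thesis using \<epsilon> by (simp add: field_simps)
        qed
        then have r\<epsilon>: "r k < \<epsilon>" using rb[of k] by linarith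
        have "C * (real (q k) * r k ^ (2 * s)) \<le> 1"
          unfolding qr using small[of "\<kappa> (p k) (q k)"] \<kappa>b[of k] q(3)[of k] by simp
        moreover have "C * r k \<le> 1/16" using small[of "r k"] rb[of k] r0[of k] by simp
        ultimately obtain h where "\<And>th. \<exists>d. rs_system.solution s (q k) (r k) (w k) th \<i> trunc h d"
          using sol[rule_format, OF rs w_def rw r\<epsilon>] by blast
        then show ?thesis unfolding H_def by (rule ps_eval_rs_ps_eq_0[OF rs])
      qed
      then have "{k. ps_eval (H k) a \<noteq> 0} \<subseteq> {..<N}" by (auto simp: not_le[symmetric])
      then show False using inf finite_subset by blast
    qed
  qed
qed

end
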